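(* Let $(M^{2n+1},\varphi,\xi,\eta,g)$ be an almost $\alpha$-Kenmotsu manifold such that $h'\neq0$ and $\xi$ belongs to the $(\kappa,\mu)'$-nullity distribution, $\mu=-2\alpha^2$. Let $g'$ be the Riemannian metric locally defined by the $\mathcal D$-conformal change $$g'=e^{-2\alpha t}g+(1-e^{-2\alpha t})\eta\otimes\eta,$$ where $t$ is a local function with $\eta=dt$. Then $(\varphi,\xi,\eta,g')$ is an almost cosymplectic structure such that $\xi$ belongs to the $\kappa_c$-nullity distribution, with $\kappa_c=\kappa+\alpha^2$.
   Context: An almost contact metric manifold is a smooth manifold $M^{2n+1}$ with a $(1,1)$-tensor field $\varphi$, a vector field $\xi$, a $1$-form $\eta$ and a Riemannian metric $g$ satisfying $\varphi^2=-I+\eta\otimes\xi$, $\eta(\xi)=1$, $\varphi\xi=0$, $\eta\circ\varphi=0$, $g(\varphi X,\varphi Y)=g(X,Y)-\eta(X)\eta(Y)$. Its fundamental $2$-form is $\Phi(X,Y)=g(X,\varphi Y)$. The structure is almost $\alpha$-Kenmotsu, with $\alpha$ a real constant, here $\alpha>0$, if $d\eta=0$ and $d\Phi=2\alpha\,\eta\wedge\Phi$. It is almost cosymplectic if $d\eta=0$ and $d\Phi=0$. $\nabla$ is the Levi-Civita connection, $R_{XY}=[\nabla_X,\nabla_Y]-\nabla_{[X,Y]}$ its curvature, $\mathcal L$ the Lie derivative, and $h'=\frac{1}{2\alpha}(\mathcal L_\xi\varphi)\circ\varphi$. For real numbers $\kappa,\mu$, $\xi$ belongs to the $(\kappa,\mu)'$-nullity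 distribution of an almost $\alpha$-Kenmotsu manifold if $R_{XY}\xi=\kappa(\eta(Y)X-\eta(X)Y)+\mu(\eta(Y)h'X-\eta(X)h'Y)$ for all vector fields $X,Y$. For an almost cosymplectic structure $(\varphi,\xi,\eta,g')$, $\xi$ belongs to the $\kappa_c$-nullity distribution if the curvature tensor $R'$ of $g'$ satisfies $R'_{XY}\xi=\kappa_c(\eta(Y)X-\eta(X)Y)$ for all $X,Y$. *)

theory Defs
  imports "HOL-Analysis.Analysis" "HOL-Library.Function_Algebras"
begin

section \<open>Smooth manifolds\<close>

text \<open>\<^term>\<open>Ck_on k S f\<close> is only used for open \<^term>\<open>S\<close> in a Euclidean space, where it says
  that \<^term>\<open>f\<close> is of class \<open>C\<close>-\<open>k\<close> on \<^term>\<open>S\<close>.\<close>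

primrec Ck_on :: "nat \<Rightarrow> 'e::euclidean_space set \<Rightarrow> ('e \<Rightarrow> 'f::real_normed_vector) \<Rightarrow> bool" where
  "Ck_on 0 S f \<longleftrightarrow> continuous_on S f"
| "Ck_on (Suc k) S f \<longleftrightarrow>
     f differentiable_on S \<and> (\<forall>v. Ck_on k S (\<lambda>x. frechet_derivative f (at x) v))"

definition smooth_on :: "'e::euclidean_space set \<Rightarrow> ('e \<Rightarrow> 'f::real_normed_vector) \<Rightarrow> bool" where
  "smooth_on S f \<longleftrightarrow> (\<forall>k. Ck_on k S f)"

text \<open>The dimension of the manifold is \<open>DIM('e)\<close>. A chart is a pair of its domain and its map;
  the values of the map outside the domain are irrelevant. The atlas need not be maximal.\<close>

record ('a, 'e) mfd =
  topo :: "'a topology"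
  atlas :: "('a set \<times> ('a \<Rightarrow> 'e)) set"

definition smooth_manifold :: "('a, 'e::euclidean_space) mfd \<Rightarrow> bool" where
  "smooth_manifold M \<longleftrightarrow>
     Hausdorff_space (topo M) \<and> second_countable (topo M) \<and>
     (\<Union>(V, \<psi>)\<in>atlas M. V) = topspace (topo M) \<and>
     (\<forall>(V, \<psi>)\<in>atlas M. openin (topo M) V \<and> open (\<psi> ` V) \<and>
        homeomorphic_map (subtopology (topo M) V) (top_of_set (\<psi> ` V)) \<psi>) \<and>
     (\<forall>(V, \<psi>)\<in>atlas M. \<forall>(V', \<psi>')\<in>atlas M. smooth_on (\<psi> ` (V \<inter> V')) (\<psi>' \<circ> inv_into V \<psi>))"

definition smooth_fun :: "('a, 'e::euclidean_space) mfd \<Rightarrow> 'a set \<Rightarrow> ('a \<Rightarrow> real) \<Rightarrow> bool" where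
  "smooth_fun M W f \<longleftrightarrow> (\<forall>(V, \<psi>)\<in>atlas M. smooth_on (\<psi> ` (V \<inter> W)) (f \<circ> inv_into V \<psi>))"

definition smooth_near :: "('a, 'e::euclidean_space) mfd \<Rightarrow> 'a \<Rightarrow> ('a \<Rightarrow> real) \<Rightarrow> bool" where
  "smooth_near M p f \<longleftrightarrow> (\<exists>V. openin (topo M) V \<and> p \<in> V \<and> smooth_fun M V f)"

section \<open>Tangent vectors and vector fields\<close>

text \<open>Tangent vectors at \<open>p\<close> are the derivations at \<open>p\<close> of the algebra of functions smooth near
  \<open>p\<close>. Such functions are arbitrary away from \<open>p\<close>, so the Leibniz rule (applied with indicator
  functions of neighbourhoods of \<open>p\<close>) already forces a derivation to depend on the germ at \<open>p\<close> only.
  The value 0 at functions that are not smooth near \<open>p\<close> is a normalisation, which makes equality of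
  tangent vectors equality of HOL functions. Sums, differences and negatives of functions, tangent
  vectors and vector fields are the pointwise ones.\<close>

type_synonym 'a tvec = "('a \<Rightarrow> real) \<Rightarrow> real"
type_synonym 'a vfield = "'a \<Rightarrow> 'a tvec"

definition scale :: "real \<Rightarrow> 'a tvec \<Rightarrow> 'a tvec" (infixr \<open>\<cdot>\<close> 75) where
  "c \<cdot> v = (\<lambda>f. c * v f)"

definition tangent_space :: "('a, 'e::euclidean_space) mfd \<Rightarrow> 'a \<Rightarrow> 'a tvec set" where
  "tangent_space M p = {v.
     (\<forall>f. \<not> smooth_near M p f \<longrightarrow> v f = 0) \<and>
     (\<forall>f g. smooth_near M p f \<longrightarrow> smooth_near M p g \<longrightarrow>
        v (f + g) = v f + v g \<and> v (f * g) = f p * v g + g p * v f) \<and>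
     (\<forall>f c. smooth_near M p f \<longrightarrow> v (\<lambda>x. c * f x) = c * v f)}"

text \<open>Vector fields on an open set \<open>W\<close>; their values outside \<open>W\<close> are irrelevant, hence a vector
  field on \<open>W\<close> is also one on each open subset of \<open>W\<close>.\<close>

definition vector_fields :: "('a, 'e::euclidean_space) mfd \<Rightarrow> 'a set \<Rightarrow> 'a vfield set" where
  "vector_fields M W = {X.
     (\<forall>p\<in>W. X p \<in> tangent_space M p) \<and>
     (\<forall>V f. openin (topo M) V \<longrightarrow> V \<subseteq> W \<longrightarrow> smooth_fun M V f \<longrightarrow> smooth_fun M V (\<lambda>p. X p f))}"

definition lie_bracket :: "('a, 'e::euclidean_space) mfd \<Rightarrow> 'a vfield \<Rightarrow> 'a vfield \<Rightarrow> 'a vfield" where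
  "lie_bracket M X Y = (\<lambda>p f.
     if smooth_near M p f then X p (\<lambda>q. Y q f) - Y p (\<lambda>q. X q f) else 0)"

section \<open>Tensor fields\<close>

text \<open>Tensor fields are given by their values at points. Throughout, \<open>W\<close> is an open subset of the
  manifold, on which the structure under consideration lives (\<open>W = topspace (topo M)\<close> for a structure
  on all of \<open>M\<close>). As usual, smoothness of tensor fields and identities between tensor fields are
  tested on the vector fields defined on open subsets of \<open>W\<close>.\<close>

type_synonym 'a endo_field = "'a \<Rightarrow> 'a tvec \<Rightarrow> 'a tvec"
type_synonym 'a form1 = "'a \<Rightarrow> 'a tvec \<Rightarrow> real"
type_synonym 'a form2 = "'a \<Rightarrow> 'a tvec \<Rightarrow> 'a tvec \<Rightarrow> real"

definition endo_field :: "('a, 'e::euclidean_space) mfd \<Rightarrow> 'a set \<Rightarrow> 'a endo_field \<Rightarrow> bool" where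
  "endo_field M W \<phi> \<longleftrightarrow>
     (\<forall>p\<in>W. \<forall>u\<in>tangent_space M p. \<phi> p u \<in> tangent_space M p) \<and>
     (\<forall>p\<in>W. \<forall>u\<in>tangent_space M p. \<forall>v\<in>tangent_space M p. \<forall>c.
        \<phi> p (c \<cdot> u + v) = c \<cdot> \<phi> p u + \<phi> p v) \<and>
     (\<forall>V X. openin (topo M) V \<longrightarrow> V \<subseteq> W \<longrightarrow> X \<in> vector_fields M V \<longrightarrow>
        (\<lambda>p. \<phi> p (X p)) \<in> vector_fields M V)"

definition one_form :: "('a, 'e::euclidean_space) mfd \<Rightarrow> 'a set \<Rightarrow> 'a form1 \<Rightarrow> bool" where
  "one_form M W \<eta> \<longleftrightarrow>
     (\<forall>p\<in>W. \<forall>u\<in>tangent_space M p. \<forall>v\<in>tangent_space M p. \<forall>c.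
        \<eta> p (c \<cdot> u + v) = c * \<eta> p u + \<eta> p v) \<and>
     (\<forall>V X. openin (topo M) V \<longrightarrow> V \<subseteq> W \<longrightarrow> X \<in> vector_fields M V \<longrightarrow>
        smooth_fun M V (\<lambda>p. \<eta> p (X p)))"

definition riemannian_metric :: "('a, 'e::euclidean_space) mfd \<Rightarrow> 'a set \<Rightarrow> 'a form2 \<Rightarrow> bool" where
  "riemannian_metric M W g \<longleftrightarrow>
     (\<forall>p\<in>W. \<forall>u\<in>tangent_space M p. \<forall>v\<in>tangent_space M p. \<forall>w\<in>tangent_space M p. \<forall>c.
        g p (c \<cdot> u + v) w = c * g p u w + g p v w) \<and>
     (\<forall>p\<in>W. \<forall>u\<in>tangent_space M p. \<forall>v\<in>tangent_space M p. g p u v = g p v u) \<and>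
     (\<forall>p\<in>W. \<forall>u\<in>tangent_space M p. u \<noteq> 0 \<longrightarrow> g p u u > 0) \<and>
     (\<forall>V X Y. openin (topo M) V \<longrightarrow> V \<subseteq> W \<longrightarrow> X \<in> vector_fields M V \<longrightarrow> Y \<in> vector_fields M V \<longrightarrow>
        smooth_fun M V (\<lambda>p. g p (X p) (Y p)))"

text \<open>Exterior derivatives and the wedge product, evaluated on vector fields at a point. The common
  factor (1/3) used by some authors on both sides of \<open>d\<Phi> = 2\<alpha> \<eta>\<and>\<Phi>\<close> is omitted.\<close>

definition ext_d1 :: "('a, 'e::euclidean_space) mfd \<Rightarrow> 'a form1 \<Rightarrow> 'a vfield \<Rightarrow> 'a vfield \<Rightarrow> 'a \<Rightarrow> real" where
  "ext_d1 M \<eta> X Y p =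
     X p (\<lambda>q. \<eta> q (Y q)) - Y p (\<lambda>q. \<eta> q (X q)) - \<eta> p (lie_bracket M X Y p)"

definition ext_d2 :: "('a, 'e::euclidean_space) mfd \<Rightarrow> 'a form2 \<Rightarrow>
    'a vfield \<Rightarrow> 'a vfield \<Rightarrow> 'a vfield \<Rightarrow> 'a \<Rightarrow> real" where
  "ext_d2 M \<omega> X Y Z p =
     X p (\<lambda>q. \<omega> q (Y q) (Z q)) - Y p (\<lambda>q. \<omega> q (X q) (Z q)) + Z p (\<lambda>q. \<omega> q (X q) (Y q))
     - \<omega> p (lie_bracket M X Y p) (Z p) + \<omega> p (lie_bracket M X Z p) (Y p)
     - \<omega> p (lie_bracket M Y Z p) (X p)"

definition wedge12 :: "'a form1 \<Rightarrow> 'a form2 \<Rightarrow> 'a vfield \<Rightarrow> 'a vfield \<Rightarrow> 'a vfield \<Rightarrow> 'a \<Rightarrow> real" where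
  "wedge12 \<eta> \<omega> X Y Z p =
     \<eta> p (X p) * \<omega> p (Y p) (Z p) - \<eta> p (Y p) * \<omega> p (X p) (Z p) + \<eta> p (Z p) * \<omega> p (X p) (Y p)"

definition closed_one_form :: "('a, 'e::euclidean_space) mfd \<Rightarrow> 'a set \<Rightarrow> 'a form1 \<Rightarrow> bool" where
  "closed_one_form M W \<eta> \<longleftrightarrow>
     (\<forall>V. openin (topo M) V \<longrightarrow> V \<subseteq> W \<longrightarrow>
        (\<forall>X\<in>vector_fields M V. \<forall>Y\<in>vector_fields M V. \<forall>p\<in>V. ext_d1 M \<eta> X Y p = 0))"

section \<open>Connections and curvature\<close>

text \<open>An affine connection on \<open>W\<close> acts on the vector fields defined on open subsets of \<open>W\<close>. Its
  compatibility with restrictions is automatic: as for tangent vectors, multiply by indicator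
  functions.\<close>

definition affine_connection ::
  "('a, 'e::euclidean_space) mfd \<Rightarrow> 'a set \<Rightarrow> ('a vfield \<Rightarrow> 'a vfield \<Rightarrow> 'a vfield) \<Rightarrow> bool" where
  "affine_connection M W D \<longleftrightarrow>
     (\<forall>V. openin (topo M) V \<longrightarrow> V \<subseteq> W \<longrightarrow>
        (\<forall>X\<in>vector_fields M V. \<forall>Y\<in>vector_fields M V. D X Y \<in> vector_fields M V) \<and>
        (\<forall>X\<in>vector_fields M V. \<forall>Y\<in>vector_fields M V. \<forall>Z\<in>vector_fields M V. \<forall>p\<in>V.
           D (X + Y) Z p = D X Z p + D Y Z p \<and> D X (Y + Z) p = D X Y p + D X Z p) \<and>
        (\<forall>X\<in>vector_fields M V. \<forall>Y\<in>vector_fields M V. \<forall>f. smooth_fun M V f \<longrightarrow> (\<forall>p\<in>V.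
           D (\<lambda>q. f q \<cdot> X q) Y p = f p \<cdot> D X Y p \<and>
           D X (\<lambda>q. f q \<cdot> Y q) p = X p f \<cdot> Y p + f p \<cdot> D X Y p)))"

definition levi_civita :: "('a, 'e::euclidean_space) mfd \<Rightarrow> 'a set \<Rightarrow> 'a form2 \<Rightarrow>
    ('a vfield \<Rightarrow> 'a vfield \<Rightarrow> 'a vfield) \<Rightarrow> bool" where
  "levi_civita M W g D \<longleftrightarrow>
     affine_connection M W D \<and>
     (\<forall>V. openin (topo M) V \<longrightarrow> V \<subseteq> W \<longrightarrow>
        (\<forall>X\<in>vector_fields M V. \<forall>Y\<in>vector_fields M V. \<forall>p\<in>V.
           D X Y p - D Y X p = lie_bracket M X Y p) \<and>
        (\<forall>X\<in>vector_fields M V. \<forall>Y\<in>vector_fields M V. \<forall>Z\<in>vector_fields M V. \<forall>p\<in>V.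
           X p (\<lambda>q. g q (Y q) (Z q)) = g p (D X Y p) (Z p) + g p (Y p) (D X Z p)))"

definition curvature :: "('a, 'e::euclidean_space) mfd \<Rightarrow> ('a vfield \<Rightarrow> 'a vfield \<Rightarrow> 'a vfield) \<Rightarrow>
    'a vfield \<Rightarrow> 'a vfield \<Rightarrow> 'a vfield \<Rightarrow> 'a vfield" where
  "curvature M D X Y Z = D X (D Y Z) - D Y (D X Z) - D (lie_bracket M X Y) Z"

section \<open>Almost contact metric structures\<close>

definition almost_contact_metric :: "('a, 'e::euclidean_space) mfd \<Rightarrow> 'a set \<Rightarrow>
    'a endo_field \<Rightarrow> 'a vfield \<Rightarrow> 'a form1 \<Rightarrow> 'a form2 \<Rightarrow> bool" where
  "almost_contact_metric M W \<phi> \<xi> \<eta> g \<longleftrightarrow>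
     endo_field M W \<phi> \<and> \<xi> \<in> vector_fields M W \<and> one_form M W \<eta> \<and> riemannian_metric M W g \<and>
     (\<forall>p\<in>W. \<eta> p (\<xi> p) = 1 \<and> \<phi> p (\<xi> p) = 0) \<and>
     (\<forall>p\<in>W. \<forall>u\<in>tangent_space M p.
        \<phi> p (\<phi> p u) = - u + \<eta> p u \<cdot> \<xi> p \<and> \<eta> p (\<phi> p u) = 0) \<and>
     (\<forall>p\<in>W. \<forall>u\<in>tangent_space M p. \<forall>v\<in>tangent_space M p.
        g p (\<phi> p u) (\<phi> p v) = g p u v - \<eta> p u * \<eta> p v)"

definition fundamental_form :: "'a endo_field \<Rightarrow> 'a form2 \<Rightarrow> 'a form2" where
  "fundamental_form \<phi> g p u v = g p u (\<phi> p v)"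

definition almost_Kenmotsu :: "('a, 'e::euclidean_space) mfd \<Rightarrow> 'a set \<Rightarrow> real \<Rightarrow>
    'a endo_field \<Rightarrow> 'a vfield \<Rightarrow> 'a form1 \<Rightarrow> 'a form2 \<Rightarrow> bool" where
  "almost_Kenmotsu M W \<alpha> \<phi> \<xi> \<eta> g \<longleftrightarrow>
     almost_contact_metric M W \<phi> \<xi> \<eta> g \<and> closed_one_form M W \<eta> \<and>
     (\<forall>V. openin (topo M) V \<longrightarrow> V \<subseteq> W \<longrightarrow>
        (\<forall>X\<in>vector_fields M V. \<forall>Y\<in>vector_fields M V. \<forall>Z\<in>vector_fields M V. \<forall>p\<in>V.
           ext_d2 M (fundamental_form \<phi> g) X Y Z p
             = 2 * \<alpha> * wedge12 \<eta> (fundamental_form \<phi> g) X Y Z p))"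

definition almost_cosymplectic :: "('a, 'e::euclidean_space) mfd \<Rightarrow> 'a set \<Rightarrow>
    'a endo_field \<Rightarrow> 'a vfield \<Rightarrow> 'a form1 \<Rightarrow> 'a form2 \<Rightarrow> bool" where
  "almost_cosymplectic M W \<phi> \<xi> \<eta> g \<longleftrightarrow>
     almost_contact_metric M W \<phi> \<xi> \<eta> g \<and> closed_one_form M W \<eta> \<and>
     (\<forall>V. openin (topo M) V \<longrightarrow> V \<subseteq> W \<longrightarrow>
        (\<forall>X\<in>vector_fields M V. \<forall>Y\<in>vector_fields M V. \<forall>Z\<in>vector_fields M V. \<forall>p\<in>V.
           ext_d2 M (fundamental_form \<phi> g) X Y Z p = 0))"

definition lie_derivative_endo :: "('a, 'e::euclidean_space) mfd \<Rightarrow> 'a vfield \<Rightarrow> 'a endo_field \<Rightarrow>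
    'a vfield \<Rightarrow> 'a vfield" where
  "lie_derivative_endo M \<xi> \<phi> X =
     (\<lambda>p. lie_bracket M \<xi> (\<lambda>q. \<phi> q (X q)) p - \<phi> p (lie_bracket M \<xi> X p))"

definition h_prime :: "('a, 'e::euclidean_space) mfd \<Rightarrow> real \<Rightarrow> 'a endo_field \<Rightarrow> 'a vfield \<Rightarrow>
    'a vfield \<Rightarrow> 'a vfield" where
  "h_prime M \<alpha> \<phi> \<xi> X = (\<lambda>p. (1 / (2 * \<alpha>)) \<cdot> lie_derivative_endo M \<xi> \<phi> (\<lambda>q. \<phi> q (X q)) p)"

definition h_prime_nonzero :: "('a, 'e::euclidean_space) mfd \<Rightarrow> 'a set \<Rightarrow> real \<Rightarrow> 'a endo_field \<Rightarrow>
    'a vfield \<Rightarrow> bool" where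
  "h_prime_nonzero M W \<alpha> \<phi> \<xi> \<longleftrightarrow>
     (\<exists>V. openin (topo M) V \<and> V \<subseteq> W \<and>
        (\<exists>X\<in>vector_fields M V. \<exists>p\<in>V. h_prime M \<alpha> \<phi> \<xi> X p \<noteq> 0))"

text \<open>In the two nullity conditions \<open>D\<close> stands for the Levi-Civita connection of the metric.\<close>

definition kappa_mu_prime_nullity :: "('a, 'e::euclidean_space) mfd \<Rightarrow> 'a set \<Rightarrow> real \<Rightarrow>
    real \<Rightarrow> real \<Rightarrow> 'a endo_field \<Rightarrow> 'a vfield \<Rightarrow> 'a form1 \<Rightarrow>
    ('a vfield \<Rightarrow> 'a vfield \<Rightarrow> 'a vfield) \<Rightarrow> bool" where
  "kappa_mu_prime_nullity M W \<alpha> \<kappa> \<mu> \<phi> \<xi> \<eta> D \<longleftrightarrow>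
     (\<forall>V. openin (topo M) V \<longrightarrow> V \<subseteq> W \<longrightarrow>
        (\<forall>X\<in>vector_fields M V. \<forall>Y\<in>vector_fields M V. \<forall>p\<in>V.
           curvature M D X Y \<xi> p =
             \<kappa> \<cdot> (\<eta> p (Y p) \<cdot> X p - \<eta> p (X p) \<cdot> Y p) +
             \<mu> \<cdot> (\<eta> p (Y p) \<cdot> h_prime M \<alpha> \<phi> \<xi> X p - \<eta> p (X p) \<cdot> h_prime M \<alpha> \<phi> \<xi> Y p)))"

definition kappa_nullity :: "('a, 'e::euclidean_space) mfd \<Rightarrow> 'a set \<Rightarrow> real \<Rightarrow>
    'a vfield \<Rightarrow> 'a form1 \<Rightarrow> ('a vfield \<Rightarrow> 'a vfield \<Rightarrow> 'a vfield) \<Rightarrow> bool" where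
  "kappa_nullity M W \<kappa> \<xi> \<eta> D \<longleftrightarrow>
     (\<forall>V. openin (topo M) V \<longrightarrow> V \<subseteq> W \<longrightarrow>
        (\<forall>X\<in>vector_fields M V. \<forall>Y\<in>vector_fields M V. \<forall>p\<in>V.
           curvature M D X Y \<xi> p = \<kappa> \<cdot> (\<eta> p (Y p) \<cdot> X p - \<eta> p (X p) \<cdot> Y p)))"

definition is_differential :: "('a, 'e::euclidean_space) mfd \<Rightarrow> 'a set \<Rightarrow> 'a form1 \<Rightarrow> ('a \<Rightarrow> real) \<Rightarrow> bool" where
  "is_differential M W \<eta> t \<longleftrightarrow> smooth_fun M W t \<and> (\<forall>p\<in>W. \<forall>v\<in>tangent_space M p. \<eta> p v = v t)"

definition D_conformal_metric :: "real \<Rightarrow> ('a \<Rightarrow> real) \<Rightarrow> 'a form1 \<Rightarrow> 'a form2 \<Rightarrow> 'a form2" where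
  "D_conformal_metric \<alpha> t \<eta> g p u v =
     exp (- 2 * \<alpha> * t p) * g p u v + (1 - exp (- 2 * \<alpha> * t p)) * (\<eta> p u * \<eta> p v)"

end

theory Submission
  imports Defs
begin

text \<open>Write \<open>E = exp(- 2\<alpha>t)\<close>. The fundamental form of the deformed structure is \<open>E \<Phi>\<close>, and
  \<open>dE = - 2\<alpha>E \<eta>\<close> cancels \<open>d\<Phi> = 2\<alpha> \<eta>\<and>\<Phi>\<close>; this is why the new structure is almost cosymplectic
  (\<open>conformal_fundamental_form_closed\<close>).

  For the curvature, contracting \<open>d\<Phi> = 2\<alpha> \<eta>\<and>\<Phi>\<close> with \<open>\<xi>\<close> determines the shape operator of the leaves of
  \<open>ker \<eta>\<close>: \<open>D\<^sub>X\<xi> = \<alpha> (X - \<eta>(X)\<xi> + h'X)\<close> (lemma \<open>D_xi\<close>). The Levi-Civita connection of the deformed metric is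
  \<open>D\<close> plus an explicit symmetric tensor (\<open>conformal_connection\<close>, \<open>conformal_levi_civita\<close>); so it exists, and by
  uniqueness (\<open>levi_civita_unique\<close>) every Levi-Civita connection of the deformed metric is this one. The new
  shape operator is \<open>\<alpha>h'\<close>, and differentiating once more gives
  \<open>R'\<^sub>X\<^sub>Y\<xi> = R\<^sub>X\<^sub>Y\<xi> + \<alpha>\<^sup>2 (\<eta>(Y)X - \<eta>(X)Y) + 2\<alpha>\<^sup>2 (\<eta>(Y)h'X - \<eta>(X)h'Y)\<close>
  (\<open>conformal_curvature_xi\<close>). For \<open>\<mu> = - 2\<alpha>\<^sup>2\<close> the \<open>h'\<close>-terms cancel and \<open>\<kappa>\<close> grows by \<open>\<alpha>\<^sup>2\<close>.

  Tangent vectors are abstract derivations and fields carry arbitrary values outside their domain. The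
  preliminary work therefore concerns the locality of derivations and connections, and the chain rule for
  \<open>exp\<close>, obtained from a Hadamard factorisation (\<open>tangent_exp\<close>).\<close>

section \<open>Calculus of \<open>C\<close>-\<open>k\<close> functions\<close>

lemma Ck_on_cong:
  assumes "open S" "\<And>x. x \<in> S \<Longrightarrow> f x = g x" "Ck_on k S f"
  shows "Ck_on k S g"
  using assms(2,3)
proof (induction k arbitrary: f g)
  case 0
  then show ?case
    by (metis Ck_on.simps(1) continuous_on_cong)
next
  case (Suc k)
  have d: "(f has_derivative F) (at x) \<longleftrightarrow> (g has_derivative F) (at x)" if "x \<in> S" for F x
    using Suc.prems(1) \<open>open S\<close> that has_derivative_transform_within_open
    by (metis (no_types, lifting))
  then have fd: "frechet_derivative f (at x) = frechet_derivative g (at x)" if "x \<in> S" for x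
    using that by (simp add: frechet_derivative_def)
  have "g differentiable_on S"
    using Suc.prems(2) d \<open>open S\<close>
    by (simp add: differentiable_on_eq_differentiable_at differentiable_def)
  moreover have "Ck_on k S (\<lambda>x. frechet_derivative g (at x) v)" for v
    using Suc.IH[of "\<lambda>x. frechet_derivative f (at x) v" "\<lambda>x. frechet_derivative g (at x) v"]
      Suc.prems(2) fd by simp
  ultimately show ?case by simp
qed

lemma Ck_on_SucI:
  assumes "open S" "\<And>x. x \<in> S \<Longrightarrow> (f has_derivative f' x) (at x)"
    and "\<And>v. Ck_on k S (\<lambda>x. f' x v)"
  shows "Ck_on (Suc k) S f"
proof -
  have "f differentiable_on S"
    using assms(1,2) by (auto simp: differentiable_on_eq_differentiable_at differentiable_def)
  moreover have "Ck_on k S (\<lambda>x. frechet_derivative f (at x) v)" for v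
    by (rule Ck_on_cong[OF assms(1) _ assms(3)]) (simp add: frechet_derivative_at[OF assms(2)])
  ultimately show ?thesis by simp
qed

lemma Ck_on_SucD:
  assumes "open S" "Ck_on (Suc k) S f" "x \<in> S"
  shows "(f has_derivative frechet_derivative f (at x)) (at x)"
  using assms by (auto simp: differentiable_on_eq_differentiable_at frechet_derivative_works)

lemma Ck_on_mono_step: "Ck_on (Suc k) S f \<Longrightarrow> Ck_on k S f"
  by (induction k arbitrary: f) (auto intro: differentiable_imp_continuous_on)

lemma Ck_on_subset:
  assumes "open T" "T \<subseteq> S" "Ck_on k S f"
  shows "Ck_on k T f"
  using assms(3)
  by (induction k arbitrary: f)
    (auto intro: continuous_on_subset[OF _ assms(2)] differentiable_on_subset[OF _ assms(2)])

lemma Ck_on_const: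
  assumes "open S"
  shows "Ck_on k S (\<lambda>_. c)"
proof (induction k arbitrary: c)
  case (Suc k)
  show ?case
    by (rule Ck_on_SucI[OF assms has_derivative_const Suc])
qed simp

lemma Ck_on_add:
  assumes "open S" "Ck_on k S f" "Ck_on k S g"
  shows "Ck_on k S (\<lambda>x. f x + g x)"
  using assms(2,3)
proof (induction k arbitrary: f g)
  case (Suc k)
  show ?case
  proof (rule Ck_on_SucI[OF assms(1)])
    show "((\<lambda>x. f x + g x) has_derivative
        (\<lambda>v. frechet_derivative f (at x) v + frechet_derivative g (at x) v)) (at x)" if "x \<in> S" for x
      by (rule has_derivative_add[OF Ck_on_SucD[OF assms(1) Suc.prems(1) that]
            Ck_on_SucD[OF assms(1) Suc.prems(2) that]])
    show "Ck_on k S (\<lambda>x. frechet_derivative f (at x) v + frechet_derivative g (at x) v)" for v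
      using Suc.prems by (intro Suc.IH) auto
  qed
qed (simp add: continuous_on_add)

lemma Ck_on_mult:
  fixes f g :: "'e::euclidean_space \<Rightarrow> real"
  assumes "open S" "Ck_on k S f" "Ck_on k S g"
  shows "Ck_on k S (\<lambda>x. f x * g x)"
  using assms(2,3)
proof (induction k arbitrary: f g)
  case (Suc k)
  show ?case
  proof (rule Ck_on_SucI[OF assms(1)])
    show "((\<lambda>x. f x * g x) has_derivative
        (\<lambda>v. f x * frechet_derivative g (at x) v + frechet_derivative f (at x) v * g x)) (at x)"
      if "x \<in> S" for x
      by (rule has_derivative_mult[OF Ck_on_SucD[OF assms(1) Suc.prems(1) that]
            Ck_on_SucD[OF assms(1) Suc.prems(2) that]])
    show "Ck_on k S (\<lambda>x. f x * frechet_derivative g (at x) v + frechet_derivative f (at x) v * g x)"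
      for v
      using Suc.prems by (intro Ck_on_add[OF assms(1)] Suc.IH) (auto intro: Ck_on_mono_step)
  qed
qed (simp add: continuous_on_mult)

text \<open>Instead of composing with an arbitrary smooth function, it suffices to compose with the members
  of a sequence in which each function is the derivative of its predecessor: by the chain rule the
  derivative of \<^term>\<open>F m \<circ> f\<close> is again of this kind, up to a factor of class \<open>C\<close>-\<open>k\<close>, and the induction
  closes. Both \<^term>\<open>exp\<close> and the quotient below fit this pattern.\<close>

lemma Ck_on_compose_DERIV_chain:
  fixes f :: "'e::euclidean_space \<Rightarrow> real" and F :: "nat \<Rightarrow> real \<Rightarrow> real"
  assumes "open S" "\<And>m s. (F m has_real_derivative F (Suc m) s) (at s)" "Ck_on k S f"
  shows "Ck_on k S (\<lambda>x. F m (f x))"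
  using assms(3)
proof (induction k arbitrary: m)
  case 0
  have "continuous_on UNIV (F m)"
    using assms(2) by (auto intro: continuous_at_imp_continuous_on DERIV_isCont)
  then show ?case
    using 0 by (auto intro: continuous_on_compose2)
next
  case (Suc k)
  show ?case
  proof (rule Ck_on_SucI[OF assms(1)])
    show "((\<lambda>x. F m (f x)) has_derivative (\<lambda>v. F (Suc m) (f x) * frechet_derivative f (at x) v)) (at x)"
      if "x \<in> S" for x
      using has_derivative_compose[OF Ck_on_SucD[OF assms(1) Suc.prems that]
          assms(2)[unfolded has_field_derivative_def]] .
    show "Ck_on k S (\<lambda>x. F (Suc m) (f x) * frechet_derivative f (at x) v)" for v
      using Suc.prems by (intro Ck_on_mult[OF assms(1)] Suc.IH) (auto intro: Ck_on_mono_step)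
  qed
qed

text \<open>For \<open>m = 0\<close> this is the entire function \<open>(exp s - 1) / s\<close>, with its value \<open>1\<close> at \<open>s = 0\<close>, and in
  general its \<open>m\<close>-th derivative. It is the Hadamard factor needed to differentiate an exponential along an
  abstract derivation.\<close>

definition exp_quotient :: "nat \<Rightarrow> real \<Rightarrow> real" where
  "exp_quotient m s = (\<Sum>n. (diffs ^^ m) (\<lambda>n. 1 / fact (Suc n)) n * s ^ n)"

lemma summable_exp_quotient: "summable (\<lambda>n. (diffs ^^ m) (\<lambda>n. 1 / fact (Suc n)) n * (s::real) ^ n)"
proof (induction m arbitrary: s)
  case 0
  have "summable (\<lambda>n. (\<bar>s\<bar> ^ n) / fact n)"
    using summable_exp[of "\<bar>s\<bar>"] by (simp add: field_simps)
  then show ?case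
  proof (rule summable_comparison_test[rotated], intro exI allI impI)
    fix n
    have "\<bar>s\<bar> ^ n / fact (Suc n) \<le> \<bar>s\<bar> ^ n / fact n"
      by (intro divide_left_mono fact_mono) auto
    then show "norm ((diffs ^^ 0) (\<lambda>n. 1 / fact (Suc n)) n * s ^ n) \<le> \<bar>s\<bar> ^ n / fact n"
      by (simp add: abs_mult power_abs)
  qed
next
  case (Suc m)
  then show ?case
    using termdiff_converges_all by auto
qed

lemma DERIV_exp_quotient: "(exp_quotient m has_real_derivative exp_quotient (Suc m) s) (at s)"
  unfolding exp_quotient_def
  using termdiffs_strong_converges_everywhere[OF summable_exp_quotient] by simp

lemma exp_quotient_0: "exp_quotient 0 0 = 1"
  using powser_zero[of "\<lambda>n. 1 / fact (Suc n) :: real"] by (simp add: exp_quotient_def)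

lemma mult_exp_quotient: "s * exp_quotient 0 s = exp s - 1"
proof -
  have "s * exp_quotient 0 s = (\<Sum>n. s * (1 / fact (Suc n) * s ^ n))"
    unfolding exp_quotient_def using suminf_mult[OF summable_exp_quotient[of 0 s], of s] by simp
  also have "\<dots> = (\<Sum>n. s ^ Suc n /\<^sub>R fact (Suc n))"
    by (simp add: field_simps)
  also have "\<dots> = exp s - 1"
    using exp_first_term[of s] by simp
  finally show ?thesis .
qed

lemmas tvec_simps = fun_eq_iff scale_def

section \<open>Smooth functions on a manifold\<close>

locale smooth_mfd =
  fixes M :: "('a, 'e::euclidean_space) mfd"
  assumes smooth_manifold: "smooth_manifold M"
begin

lemma chart_inv: "(V, \<psi>) \<in> atlas M \<Longrightarrow> x \<in> V \<Longrightarrow> inv_into V \<psi> (\<psi> x) = x"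
  using smooth_manifold openin_subset[of "topo M" V]
  unfolding smooth_manifold_def
  by (fastforce dest!: homeomorphic_imp_injective_map intro!: inv_into_f_f simp: Int_absorb1)

lemma open_chart_image:
  assumes "(V, \<psi>) \<in> atlas M" "openin (topo M) W"
  shows "open (\<psi> ` (V \<inter> W))"
proof -
  have h: "open (\<psi> ` V)" "homeomorphic_map (subtopology (topo M) V) (top_of_set (\<psi> ` V)) \<psi>"
    using smooth_manifold assms(1) unfolding smooth_manifold_def by blast+
  have "openin (subtopology (topo M) V) (V \<inter> W)"
    using assms(2) by (simp add: openin_subtopology_Int2)
  then have "openin (top_of_set (\<psi> ` V)) (\<psi> ` (V \<inter> W))"
    using h(2) homeomorphic_imp_open_map open_map_def by blast
  then show ?thesis
    using h(1) openin_open_trans by blast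
qed

lemma smooth_funI:
  assumes "openin (topo M) W"
    and "\<And>V \<psi> k S. (V, \<psi>) \<in> atlas M \<Longrightarrow> open S \<Longrightarrow> S = \<psi> ` (V \<inter> W) \<Longrightarrow> Ck_on k S (\<lambda>x. f (inv_into V \<psi> x))"
  shows "smooth_fun M W f"
  using assms open_chart_image unfolding smooth_fun_def smooth_on_def comp_def by blast

lemma smooth_funD:
  assumes "smooth_fun M W f" "(V, \<psi>) \<in> atlas M" "S = \<psi> ` (V \<inter> W)"
  shows "Ck_on k S (\<lambda>x. f (inv_into V \<psi> x))"
  using assms unfolding smooth_fun_def smooth_on_def comp_def by blast

lemma smooth_fun_cong:
  assumes "openin (topo M) W" "smooth_fun M W f" "\<And>p. p \<in> W \<Longrightarrow> f p = g p"
  shows "smooth_fun M W g"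
proof (rule smooth_funI[OF assms(1)])
  fix V \<psi> k S assume c: "(V, \<psi>) \<in> atlas M" "open S" "S = \<psi> ` (V \<inter> W)"
  show "Ck_on k S (\<lambda>x. g (inv_into V \<psi> x))"
  proof (rule Ck_on_cong[OF c(2) _ smooth_funD[OF assms(2) c(1,3)]])
    show "f (inv_into V \<psi> x) = g (inv_into V \<psi> x)" if "x \<in> S" for x
      using that c chart_inv assms(3) by auto
  qed
qed

lemma smooth_fun_subset:
  assumes "openin (topo M) W'" "W' \<subseteq> W" "smooth_fun M W f"
  shows "smooth_fun M W' f"
proof (rule smooth_funI[OF assms(1)])
  fix V \<psi> k S assume c: "(V, \<psi>) \<in> atlas M" "open S" "S = \<psi> ` (V \<inter> W')"
  show "Ck_on k S (\<lambda>x. f (inv_into V \<psi> x))"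
    by (rule Ck_on_subset[OF c(2) _ smooth_funD[OF assms(3) c(1) refl]]) (use assms(2) c in auto)
qed

lemma smooth_fun_const: "openin (topo M) W \<Longrightarrow> smooth_fun M W (\<lambda>_. c)"
  by (rule smooth_funI) (simp_all add: Ck_on_const)

lemma smooth_fun_add:
  "openin (topo M) W \<Longrightarrow> smooth_fun M W f \<Longrightarrow> smooth_fun M W g \<Longrightarrow> smooth_fun M W (\<lambda>p. f p + g p)"
  by (rule smooth_funI) (simp_all add: Ck_on_add smooth_funD)

lemma smooth_fun_mult:
  "openin (topo M) W \<Longrightarrow> smooth_fun M W f \<Longrightarrow> smooth_fun M W g \<Longrightarrow> smooth_fun M W (\<lambda>p. f p * g p)"
  by (rule smooth_funI) (simp_all add: Ck_on_mult smooth_funD)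

lemma smooth_fun_diff:
  "openin (topo M) W \<Longrightarrow> smooth_fun M W f \<Longrightarrow> smooth_fun M W g \<Longrightarrow> smooth_fun M W (\<lambda>p. f p - g p)"
  using smooth_fun_add[of W f "\<lambda>p. - 1 * g p"] smooth_fun_mult[of W "\<lambda>_. - 1" g] smooth_fun_const
  by simp

lemma smooth_fun_compose_DERIV_chain:
  assumes "openin (topo M) W" "\<And>m s. (F m has_real_derivative F (Suc m) s) (at s)" "smooth_fun M W f"
  shows "smooth_fun M W (\<lambda>p. F m (f p))"
  by (rule smooth_funI[OF assms(1)])
    (rule Ck_on_compose_DERIV_chain[of _ F, OF _ assms(2) smooth_funD[OF assms(3)]])

lemma smooth_fun_exp: "openin (topo M) W \<Longrightarrow> smooth_fun M W f \<Longrightarrow> smooth_fun M W (\<lambda>p. exp (f p))"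
  using smooth_fun_compose_DERIV_chain[of W "\<lambda>_. exp" f] by (simp add: DERIV_exp)

lemmas smooth_fun_intros =
  smooth_fun_const smooth_fun_add smooth_fun_mult smooth_fun_diff smooth_fun_exp

lemma smooth_nearI: "openin (topo M) V \<Longrightarrow> p \<in> V \<Longrightarrow> smooth_fun M V f \<Longrightarrow> smooth_near M p f"
  unfolding smooth_near_def by blast

lemma smooth_near_cong:
  assumes "openin (topo M) V" "p \<in> V" "\<And>q. q \<in> V \<Longrightarrow> f q = g q" "smooth_near M p f"
  shows "smooth_near M p g"
proof -
  obtain W where W: "openin (topo M) W" "p \<in> W" "smooth_fun M W f"
    using assms(4) unfolding smooth_near_def by blast
  have o: "openin (topo M) (V \<inter> W)"
    using assms(1) W(1) by blast
  have "smooth_fun M (V \<inter> W) g"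
    by (rule smooth_fun_cong[OF o smooth_fun_subset[OF o _ W(3)]]) (use assms(3) in auto)
  then show ?thesis
    using smooth_nearI[OF o] assms(2) W(2) by blast
qed

lemma smooth_near_Int:
  assumes "smooth_near M p f" "smooth_near M p g"
  obtains V where "openin (topo M) V" "p \<in> V" "smooth_fun M V f" "smooth_fun M V g"
proof -
  obtain V W where "openin (topo M) V" "p \<in> V" "smooth_fun M V f"
    "openin (topo M) W" "p \<in> W" "smooth_fun M W g"
    using assms unfolding smooth_near_def by blast
  then show thesis
    by (intro that[of "V \<inter> W"]) (auto intro: smooth_fun_subset[of "V \<inter> W"])
qed

section \<open>Tangent vectors as derivations\<close>

lemma tangent_spaceI:
  assumes "\<And>f. \<not> smooth_near M p f \<Longrightarrow> v f = 0"
    and "\<And>f g. smooth_near M p f \<Longrightarrow> smooth_near M p g \<Longrightarrow> v (\<lambda>q. f q + g q) = v f + v g"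
    and "\<And>f g. smooth_near M p f \<Longrightarrow> smooth_near M p g \<Longrightarrow>
      v (\<lambda>q. f q * g q) = f p * v g + g p * v f"
    and "\<And>f c. smooth_near M p f \<Longrightarrow> v (\<lambda>q. c * f q) = c * v f"
  shows "v \<in> tangent_space M p"
  using assms unfolding tangent_space_def plus_fun_def times_fun_def by blast

lemma tangent_nonsmooth: "v \<in> tangent_space M p \<Longrightarrow> \<not> smooth_near M p f \<Longrightarrow> v f = 0"
  unfolding tangent_space_def by blast

lemma tangent_add:
  "v \<in> tangent_space M p \<Longrightarrow> smooth_near M p f \<Longrightarrow> smooth_near M p g \<Longrightarrow>
    v (\<lambda>q. f q + g q) = v f + v g"
  unfolding tangent_space_def by (simp add: plus_fun_def)

lemma tangent_mult:
  "v \<in> tangent_space M p \<Longrightarrow> smooth_near M p f \<Longrightarrow> smooth_near M p g \<Longrightarrow>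
    v (\<lambda>q. f q * g q) = f p * v g + g p * v f"
  unfolding tangent_space_def by (simp add: times_fun_def)

lemma tangent_cmult:
  "v \<in> tangent_space M p \<Longrightarrow> smooth_near M p f \<Longrightarrow> v (\<lambda>q. c * f q) = c * v f"
  unfolding tangent_space_def by simp

text \<open>Since the indicator function \<open>\<iota>\<close> of \<open>V\<close> is smooth near \<open>p\<close> and idempotent, the Leibniz rule gives
  \<open>v \<iota> = 2 v \<iota>\<close>, that is \<open>v \<iota> = 0\<close>; hence \<open>v f = v (\<iota> f)\<close>, and the right-hand side sees only \<open>f\<close> on \<open>V\<close>.\<close>

lemma tangent_local:
  assumes v: "v \<in> tangent_space M p" and V: "openin (topo M) V" "p \<in> V"
    and eq: "\<And>q. q \<in> V \<Longrightarrow> f q = g q"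
  shows "v f = v g"
proof (cases "smooth_near M p f")
  case True
  then have g: "smooth_near M p g"
    using smooth_near_cong[OF V] eq by blast
  define \<iota> :: "'a \<Rightarrow> real" where "\<iota> = indicator V"
  have \<iota>: "smooth_near M p \<iota>" "\<iota> p = 1"
    using smooth_near_cong[OF V _ smooth_nearI[OF V smooth_fun_const[OF V(1)]], of 1 \<iota>] V
    by (auto simp: \<iota>_def)
  have "(\<lambda>q. \<iota> q * \<iota> q) = \<iota>"
    by (auto simp: \<iota>_def indicator_def)
  then have "v \<iota> = 0"
    using tangent_mult[OF v \<iota>(1) \<iota>(1)] \<iota>(2) by simp
  moreover have "(\<lambda>q. \<iota> q * f q) = (\<lambda>q. \<iota> q * g q)"
    using eq by (auto simp: \<iota>_def indicator_def)
  ultimately show ?thesis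
    using tangent_mult[OF v \<iota>(1) True] tangent_mult[OF v \<iota>(1) g] \<iota>(2) by simp
next
  case False
  then have "\<not> smooth_near M p g"
    using smooth_near_cong[OF V, of g f] eq by auto
  with False show ?thesis
    using v by (simp add: tangent_nonsmooth)
qed

lemma tangent_const:
  assumes "v \<in> tangent_space M p" "openin (topo M) V" "p \<in> V"
  shows "v (\<lambda>_. c) = 0"
proof -
  have s: "smooth_near M p (\<lambda>_. k)" for k :: real
    using assms by (blast intro: smooth_nearI smooth_fun_const)
  show ?thesis
    using tangent_mult[OF assms(1) s s, of 1 1] tangent_cmult[OF assms(1) s[of 1], of c] by simp
qed

lemma tangent_diff:
  assumes "v \<in> tangent_space M p" "smooth_near M p f" "smooth_near M p g"
  shows "v (\<lambda>q. f q - g q) = v f - v g"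
proof -
  obtain V where V: "openin (topo M) V" "p \<in> V" "smooth_fun M V g"
    using assms(3) unfolding smooth_near_def by blast
  have "smooth_near M p (\<lambda>q. - 1 * g q)"
    by (rule smooth_nearI[OF V(1,2)]) (intro smooth_fun_intros V)
  then show ?thesis
    using tangent_add[OF assms(1,2), of "\<lambda>q. - 1 * g q"] tangent_cmult[OF assms(1,3), of "- 1"] by simp
qed

text \<open>The chain rule for a derivation is not part of its definition. Writing \<open>exp u - 1 = u H(u)\<close> with
  \<open>u = f - f(p)\<close> and \<open>H(0) = 1\<close>, the Leibniz rule yields \<open>v (exp u) = v u\<close>, because \<open>u\<close> vanishes at \<open>p\<close>.\<close>

lemma tangent_exp:
  assumes v: "v \<in> tangent_space M p" and V: "openin (topo M) V" "p \<in> V" "smooth_fun M V f"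
  shows "v (\<lambda>q. exp (f q)) = exp (f p) * v f"
proof -
  define u where "u q = f q - f p" for q
  have us: "smooth_fun M V u"
    unfolding u_def by (intro smooth_fun_intros V)
  have hs: "smooth_fun M V (\<lambda>q. exp_quotient 0 (u q))"
    by (rule smooth_fun_compose_DERIV_chain[of V exp_quotient, OF V(1) DERIV_exp_quotient us])
  note near = smooth_nearI[OF V(1,2)]
  have vu: "v u = v f"
    unfolding u_def using tangent_diff[OF v near near, of f "\<lambda>_. f p"] tangent_const[OF v V(1,2)]
      V smooth_fun_const by simp
  have "v (\<lambda>q. u q * exp_quotient 0 (u q)) = v f"
    using tangent_mult[OF v near[OF us] near[OF hs]] vu by (simp add: u_def exp_quotient_0)
  moreover have "(\<lambda>q. exp (f q)) = (\<lambda>q. exp (f p) * (u q * exp_quotient 0 (u q) + 1))"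
    by (rule ext) (simp add: mult_exp_quotient u_def exp_diff)
  moreover have "v (\<lambda>q. exp (f p) * (u q * exp_quotient 0 (u q) + 1))
      = exp (f p) * (v (\<lambda>q. u q * exp_quotient 0 (u q)) + v (\<lambda>_. 1))"
    by (subst tangent_cmult[OF v near], intro smooth_fun_intros V us hs, subst tangent_add[OF v near near])
      (intro smooth_fun_intros V us hs refl)+
  ultimately show ?thesis
    using tangent_const[OF v V(1,2)] by simp
qed

lemma tangent_space_add:
  "u \<in> tangent_space M p \<Longrightarrow> v \<in> tangent_space M p \<Longrightarrow> u + v \<in> tangent_space M p"
  unfolding tangent_space_def by (simp add: algebra_simps)

lemma tangent_space_scale: "u \<in> tangent_space M p \<Longrightarrow> c \<cdot> u \<in> tangent_space M p"
  unfolding tangent_space_def by (simp add: algebra_simps scale_def)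

lemma tangent_space_zero: "0 \<in> tangent_space M p"
  unfolding tangent_space_def by simp

section \<open>Vector fields\<close>

lemma vf_tangent: "X \<in> vector_fields M W \<Longrightarrow> p \<in> W \<Longrightarrow> X p \<in> tangent_space M p"
  unfolding vector_fields_def by blast

lemma vf_smooth:
  "X \<in> vector_fields M W \<Longrightarrow> openin (topo M) V \<Longrightarrow> V \<subseteq> W \<Longrightarrow> smooth_fun M V f \<Longrightarrow>
    smooth_fun M V (\<lambda>p. X p f)"
  unfolding vector_fields_def by blast

lemma vf_subset: "X \<in> vector_fields M W \<Longrightarrow> V \<subseteq> W \<Longrightarrow> X \<in> vector_fields M V"
  unfolding vector_fields_def by (auto 5 2)

lemma vf_add: "X \<in> vector_fields M W \<Longrightarrow> Y \<in> vector_fields M W \<Longrightarrow> (\<lambda>p. X p + Y p) \<in> vector_fields M W"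
  unfolding vector_fields_def by (auto intro: tangent_space_add smooth_fun_add)

lemma vf_scale:
  "smooth_fun M W f \<Longrightarrow> X \<in> vector_fields M W \<Longrightarrow> (\<lambda>p. f p \<cdot> X p) \<in> vector_fields M W"
  unfolding vector_fields_def
  using tangent_space_scale by (auto simp: scale_def intro!: smooth_fun_mult intro: smooth_fun_subset)

lemma scale_minus_one: "- 1 \<cdot> u = - u"
  by (simp add: scale_def fun_eq_iff)

lemma vf_diff:
  assumes "openin (topo M) W" "X \<in> vector_fields M W" "Y \<in> vector_fields M W"
  shows "(\<lambda>p. X p - Y p) \<in> vector_fields M W"
  using vf_add[OF assms(2) vf_scale[OF smooth_fun_const[OF assms(1)] assms(3)], of "- 1"]
  by (simp add: scale_minus_one)

lemma vf_lie_bracket: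
  assumes W: "openin (topo M) W" and X: "X \<in> vector_fields M W" and Y: "Y \<in> vector_fields M W"
  shows "lie_bracket M X Y \<in> vector_fields M W"
proof -
  have "smooth_fun M V (\<lambda>p. lie_bracket M X Y p f)"
    if V: "openin (topo M) V" "V \<subseteq> W" "smooth_fun M V f" for V f
  proof (rule smooth_fun_cong[OF V(1)])
    show "smooth_fun M V (\<lambda>p. X p (\<lambda>q. Y q f) - Y p (\<lambda>q. X q f))"
      by (intro smooth_fun_diff vf_smooth[OF X] vf_smooth[OF Y] V)
    show "X p (\<lambda>q. Y q f) - Y p (\<lambda>q. X q f) = lie_bracket M X Y p f" if "p \<in> V" for p
      using smooth_nearI[OF V(1) that V(3)] by (simp add: lie_bracket_def)
  qed
  moreover have "lie_bracket M X Y p \<in> tangent_space M p" if p: "p \<in> W" for p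
  proof -
    note Xp = vf_tangent[OF X p] and Yp = vf_tangent[OF Y p]
    \<comment> \<open>Iterated derivatives \<open>Z (Z' f)\<close> fail the Leibniz rule by terms symmetric in \<open>Z\<close> and \<open>Z'\<close>,
      which cancel in the bracket.\<close>
    have second: "Z p (\<lambda>q. Z' q (\<lambda>x. f x + g x)) = Z p (\<lambda>q. Z' q f) + Z p (\<lambda>q. Z' q g)"
      "Z p (\<lambda>q. Z' q (\<lambda>x. f x * g x)) =
         f p * Z p (\<lambda>q. Z' q g) + Z' p g * Z p f + g p * Z p (\<lambda>q. Z' q f) + Z' p f * Z p g"
      "Z p (\<lambda>q. Z' q (\<lambda>x. c * f x)) = c * Z p (\<lambda>q. Z' q f)"
      if f: "smooth_near M p f" and g: "smooth_near M p g"
        and Z: "Z \<in> vector_fields M W" and Z': "Z' \<in> vector_fields M W" for f g Z Z' c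
    proof -
      obtain V0 where V0: "openin (topo M) V0" "p \<in> V0" "smooth_fun M V0 f" "smooth_fun M V0 g"
        using smooth_near_Int[OF f g] .
      define V where "V = V0 \<inter> W"
      have V: "openin (topo M) V" "p \<in> V" "V \<subseteq> W"
        using V0 W p by (auto simp: V_def)
      have fs: "smooth_fun M V f" "smooth_fun M V g"
        using V0 smooth_fun_subset[OF V(1)] by (auto simp: V_def)
      have ds: "smooth_fun M V (\<lambda>q. Z' q f)" "smooth_fun M V (\<lambda>q. Z' q g)"
        using vf_smooth[OF Z' V(1,3)] fs by auto
      note near = smooth_nearI[OF V(1)]
      note Zp = vf_tangent[OF Z p]
      have Z'q: "Z' q \<in> tangent_space M q" if "q \<in> V" for q
        using vf_tangent[OF Z'] V(3) that by auto
      have "Z p (\<lambda>q. Z' q (\<lambda>x. f x + g x)) = Z p (\<lambda>q. Z' q f + Z' q g)"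
        by (rule tangent_local[OF Zp V(1,2)]) (blast intro: tangent_add Z'q near fs)
      also have "\<dots> = Z p (\<lambda>q. Z' q f) + Z p (\<lambda>q. Z' q g)"
        by (intro tangent_add[OF Zp] near ds V)
      finally show "Z p (\<lambda>q. Z' q (\<lambda>x. f x + g x)) = Z p (\<lambda>q. Z' q f) + Z p (\<lambda>q. Z' q g)" .
      have "Z p (\<lambda>q. Z' q (\<lambda>x. f x * g x)) = Z p (\<lambda>q. f q * Z' q g + g q * Z' q f)"
        by (rule tangent_local[OF Zp V(1,2)]) (blast intro: tangent_mult Z'q near fs)
      also have "\<dots> = Z p (\<lambda>q. f q * Z' q g) + Z p (\<lambda>q. g q * Z' q f)"
        by (intro tangent_add[OF Zp] near smooth_fun_mult ds fs V)
      also have "\<dots> = (f p * Z p (\<lambda>q. Z' q g) + Z' p g * Z p f) + (g p * Z p (\<lambda>q. Z' q f) + Z' p f * Z p g)"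
        by (intro arg_cong2[of _ _ _ _ "(+)"] tangent_mult[OF Zp] near ds fs V)
      finally show "Z p (\<lambda>q. Z' q (\<lambda>x. f x * g x)) =
         f p * Z p (\<lambda>q. Z' q g) + Z' p g * Z p f + g p * Z p (\<lambda>q. Z' q f) + Z' p f * Z p g" by simp
      have "Z p (\<lambda>q. Z' q (\<lambda>x. c * f x)) = Z p (\<lambda>q. c * Z' q f)"
        by (rule tangent_local[OF Zp V(1,2)]) (blast intro: tangent_cmult Z'q near fs)
      also have "\<dots> = c * Z p (\<lambda>q. Z' q f)"
        by (intro tangent_cmult[OF Zp] near ds V)
      finally show "Z p (\<lambda>q. Z' q (\<lambda>x. c * f x)) = c * Z p (\<lambda>q. Z' q f)" .
    qed
    have closed: "smooth_near M p (\<lambda>q. f q + g q) \<and> smooth_near M p (\<lambda>q. f q * g q) \<and>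
        smooth_near M p (\<lambda>q. c * f q)"
      if near: "smooth_near M p f" "smooth_near M p g" for f g c
    proof -
      obtain V where "openin (topo M) V" "p \<in> V" "smooth_fun M V f" "smooth_fun M V g"
        using smooth_near_Int[OF near] .
      then show ?thesis
        by (intro conjI smooth_nearI[of V] smooth_fun_intros)
    qed
    show ?thesis
    proof (rule tangent_spaceI)
      show "lie_bracket M X Y p f = 0" if "\<not> smooth_near M p f" for f
        using that by (simp add: lie_bracket_def)
      have lb: "lie_bracket M X Y p f = X p (\<lambda>q. Y q f) - Y p (\<lambda>q. X q f)" if "smooth_near M p f" for f
        using that by (simp add: lie_bracket_def)
      fix f g c assume fg: "smooth_near M p f" "smooth_near M p g"
      note lbs = lb[OF fg(1)] lb[OF fg(2)]
      show "lie_bracket M X Y p (\<lambda>q. f q + g q) = lie_bracket M X Y p f + lie_bracket M X Y p g"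
        unfolding lbs lb[OF closed[OF fg, THEN conjunct1]] second(1)[OF fg X Y] second(1)[OF fg Y X]
        by simp
      show "lie_bracket M X Y p (\<lambda>q. f q * g q) = f p * lie_bracket M X Y p g + g p * lie_bracket M X Y p f"
        unfolding lbs lb[OF closed[OF fg, THEN conjunct2, THEN conjunct1]]
          second(2)[OF fg X Y] second(2)[OF fg Y X]
        by (simp add: algebra_simps)
    next
      fix f c assume f: "smooth_near M p f"
      then show "lie_bracket M X Y p (\<lambda>q. c * f q) = c * lie_bracket M X Y p f"
        using closed[OF f f, of c] second(3)[OF f f X Y, of c] second(3)[OF f f Y X, of c]
        by (simp add: lie_bracket_def right_diff_distrib)
    qed
  qed
  ultimately show ?thesis
    unfolding vector_fields_def by blast
qed

lemma tangent_space_uminus: "u \<in> tangent_space M p \<Longrightarrow> - u \<in> tangent_space M p"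
  using tangent_space_scale[of u p "- 1"] by (simp add: scale_minus_one)

lemma tangent_space_diff:
  "u \<in> tangent_space M p \<Longrightarrow> v \<in> tangent_space M p \<Longrightarrow> u - v \<in> tangent_space M p"
  using tangent_space_add[OF _ tangent_space_uminus, of u p v] by simp

lemmas tangent_space_intros =
  tangent_space_add tangent_space_scale tangent_space_diff tangent_space_uminus tangent_space_zero

lemma vf_derivative:
  assumes "openin (topo M) W" "X \<in> vector_fields M W" "p \<in> W"
  shows vf_derivative_cong: "(\<And>q. q \<in> W \<Longrightarrow> f q = g q) \<Longrightarrow> X p f = X p g"
    and vf_derivative_const: "X p (\<lambda>_. c) = 0"
    and vf_derivative_add: "smooth_fun M W f \<Longrightarrow> smooth_fun M W g \<Longrightarrow>
      X p (\<lambda>q. f q + g q) = X p f + X p g"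
    and vf_derivative_diff: "smooth_fun M W f \<Longrightarrow> smooth_fun M W g \<Longrightarrow>
      X p (\<lambda>q. f q - g q) = X p f - X p g"
    and vf_derivative_mult: "smooth_fun M W f \<Longrightarrow> smooth_fun M W g \<Longrightarrow>
      X p (\<lambda>q. f q * g q) = f p * X p g + g p * X p f"
    and vf_derivative_cmult: "smooth_fun M W f \<Longrightarrow> X p (\<lambda>q. c * f q) = c * X p f"
    and vf_derivative_exp: "smooth_fun M W f \<Longrightarrow> X p (\<lambda>q. exp (f q)) = exp (f p) * X p f"
  using vf_tangent[OF assms(2,3)] assms smooth_nearI[OF assms(1,3)]
  by (blast intro: tangent_local tangent_const tangent_add tangent_diff tangent_mult tangent_cmult
      tangent_exp)+

section \<open>Forms and metrics on tangent spaces\<close>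

lemma linear_form_tangent:
  assumes "\<And>u v c. u \<in> tangent_space M p \<Longrightarrow> v \<in> tangent_space M p \<Longrightarrow> l (c \<cdot> u + v) = c * l u + (l v :: real)"
    and "u \<in> tangent_space M p"
  shows "l 0 = 0" "l (c \<cdot> u) = c * l u" "l (- u) = - l u"
    "v \<in> tangent_space M p \<Longrightarrow> l (u + v) = l u + l v"
    "v \<in> tangent_space M p \<Longrightarrow> l (u - v) = l u - l v"
proof -
  have one: "1 \<cdot> w = w" for w :: "'a tvec"
    by (simp add: tvec_simps)
  show zero: "l 0 = 0"
    using assms(1)[OF tangent_space_zero tangent_space_zero, of 1] by (simp add: one)
  have scale: "l (c \<cdot> u) = c * l u" for c
    using assms(1)[OF assms(2) tangent_space_zero, of c] zero by simp
  then show "l (c \<cdot> u) = c * l u" .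
  show "l (- u) = - l u"
    using scale[of "- 1"] by (simp add: scale_minus_one)
  show "l (u + v) = l u + l v" if "v \<in> tangent_space M p"
    using assms(1)[OF assms(2) that, of 1] by (simp add: one)
  have "- 1 \<cdot> v + u = u - v"
    by (simp add: tvec_simps)
  then show "l (u - v) = l u - l v" if "v \<in> tangent_space M p"
    using assms(1)[OF that assms(2), of "- 1"] by simp
qed

lemma one_form_linear:
  assumes "one_form M W \<eta>" "p \<in> W" "u \<in> tangent_space M p"
  shows "\<eta> p (c \<cdot> u) = c * \<eta> p u" "\<eta> p (- u) = - \<eta> p u"
    "v \<in> tangent_space M p \<Longrightarrow> \<eta> p (u + v) = \<eta> p u + \<eta> p v"
    "v \<in> tangent_space M p \<Longrightarrow> \<eta> p (u - v) = \<eta> p u - \<eta> p v"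
proof -
  have "\<eta> p (c \<cdot> u + v) = c * \<eta> p u + \<eta> p v"
    if "u \<in> tangent_space M p" "v \<in> tangent_space M p" for u v c
    using assms(1,2) that unfolding one_form_def by blast
  note * = linear_form_tangent[of p "\<eta> p", OF this assms(3)]
  show "\<eta> p (c \<cdot> u) = c * \<eta> p u" "\<eta> p (- u) = - \<eta> p u"
    "v \<in> tangent_space M p \<Longrightarrow> \<eta> p (u + v) = \<eta> p u + \<eta> p v"
    "v \<in> tangent_space M p \<Longrightarrow> \<eta> p (u - v) = \<eta> p u - \<eta> p v"
    by (rule *; assumption)+
qed

lemma metricD:
  assumes "riemannian_metric M W g" "p \<in> W" "u \<in> tangent_space M p" "v \<in> tangent_space M p"
  shows metric_linear: "w \<in> tangent_space M p \<Longrightarrow> g p (c \<cdot> u + v) w = c * g p u w + g p v w"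
    and metric_commute: "g p u v = g p v u"
    and metric_pos: "u \<noteq> 0 \<Longrightarrow> g p u u > 0"
proof -
  note * = assms(1)[unfolded riemannian_metric_def]
  show "w \<in> tangent_space M p \<Longrightarrow> g p (c \<cdot> u + v) w = c * g p u w + g p v w"
    by (rule *[THEN conjunct1, rule_format, OF assms(2-4)])
  show "g p u v = g p v u"
    by (rule *[THEN conjunct2, THEN conjunct1, rule_format, OF assms(2-4)])
  show "u \<noteq> 0 \<Longrightarrow> g p u u > 0"
    by (rule *[THEN conjunct2, THEN conjunct2, THEN conjunct1, rule_format, OF assms(2,3)])
qed

lemma metric_bilinear:
  assumes "riemannian_metric M W g" "p \<in> W" "u \<in> tangent_space M p" "w \<in> tangent_space M p"
  shows "g p 0 w = 0" "g p (c \<cdot> u) w = c * g p u w" "g p (- u) w = - g p u w"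
    "v \<in> tangent_space M p \<Longrightarrow> g p (u + v) w = g p u w + g p v w"
    "v \<in> tangent_space M p \<Longrightarrow> g p (u - v) w = g p u w - g p v w"
    "g p w 0 = 0" "g p w (c \<cdot> u) = c * g p w u" "g p w (- u) = - g p w u"
    "v \<in> tangent_space M p \<Longrightarrow> g p w (u + v) = g p w u + g p w v"
    "v \<in> tangent_space M p \<Longrightarrow> g p w (u - v) = g p w u - g p w v"
proof -
  note * = linear_form_tangent[of p "\<lambda>u. g p u w", OF metric_linear[OF assms(1,2) _ _ assms(4)] assms(3)]
  show left: "g p 0 w = 0" "g p (c \<cdot> u) w = c * g p u w" "g p (- u) w = - g p u w"
    "v \<in> tangent_space M p \<Longrightarrow> g p (u + v) w = g p u w + g p v w"
    "v \<in> tangent_space M p \<Longrightarrow> g p (u - v) w = g p u w - g p v w"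
    by (rule *; assumption)+
  have sym: "g p w x = g p x w" if "x \<in> tangent_space M p" for x
    by (rule metric_commute[OF assms(1,2,4) that])
  show "g p w 0 = 0" "g p w (c \<cdot> u) = c * g p w u" "g p w (- u) = - g p w u"
    "v \<in> tangent_space M p \<Longrightarrow> g p w (u + v) = g p w u + g p w v"
    "v \<in> tangent_space M p \<Longrightarrow> g p w (u - v) = g p w u - g p w v"
    using left sym assms(3) by (simp_all add: tangent_space_intros)
qed

section \<open>Affine connections\<close>

lemma connection_rules:
  assumes "affine_connection M W D" "openin (topo M) W"
    and "X \<in> vector_fields M W" "Y \<in> vector_fields M W"
  shows connection_vf: "D X Y \<in> vector_fields M W"
    and connection_add_left: "Z \<in> vector_fields M W \<Longrightarrow> p \<in> W \<Longrightarrow>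
      D (\<lambda>q. X q + Y q) Z p = D X Z p + D Y Z p"
    and connection_add_right: "Z \<in> vector_fields M W \<Longrightarrow> p \<in> W \<Longrightarrow>
      D X (\<lambda>q. Y q + Z q) p = D X Y p + D X Z p"
    and connection_scale_left: "smooth_fun M W f \<Longrightarrow> p \<in> W \<Longrightarrow>
      D (\<lambda>q. f q \<cdot> X q) Y p = f p \<cdot> D X Y p"
    and connection_scale_right: "smooth_fun M W f \<Longrightarrow> p \<in> W \<Longrightarrow>
      D X (\<lambda>q. f q \<cdot> Y q) p = X p f \<cdot> Y p + f p \<cdot> D X Y p"
proof -
  note * = assms(1)[unfolded affine_connection_def plus_fun_def[where ?'b = "'a tvec"], rule_format,
      OF assms(2) subset_refl]
  show "D X Y \<in> vector_fields M W"
    by (rule *[THEN conjunct1, rule_format, OF assms(3,4)])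
  show "D (\<lambda>q. X q + Y q) Z p = D X Z p + D Y Z p" "D X (\<lambda>q. Y q + Z q) p = D X Y p + D X Z p"
    if "Z \<in> vector_fields M W" "p \<in> W"
    using *[THEN conjunct2, THEN conjunct1, rule_format, OF assms(3,4) that] by auto
  show "D (\<lambda>q. f q \<cdot> X q) Y p = f p \<cdot> D X Y p"
    "D X (\<lambda>q. f q \<cdot> Y q) p = X p f \<cdot> Y p + f p \<cdot> D X Y p"
    if "smooth_fun M W f" "p \<in> W"
    using *[THEN conjunct2, THEN conjunct2, rule_format, OF assms(3,4) that] by auto
qed

lemma levi_civitaD:
  assumes "levi_civita M W g D" "openin (topo M) W" "p \<in> W"
    and "X \<in> vector_fields M W" "Y \<in> vector_fields M W"
  shows levi_civita_torsion_free: "lie_bracket M X Y p = D X Y p - D Y X p"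
    and levi_civita_metric: "Z \<in> vector_fields M W \<Longrightarrow>
      X p (\<lambda>q. g q (Y q) (Z q)) = g p (D X Y p) (Z p) + g p (Y p) (D X Z p)"
proof -
  note * = assms(1)[unfolded levi_civita_def, THEN conjunct2, rule_format, OF assms(2) subset_refl]
  show "lie_bracket M X Y p = D X Y p - D Y X p"
    by (rule *[THEN conjunct1, rule_format, OF assms(4,5,3), symmetric])
  show "Z \<in> vector_fields M W \<Longrightarrow>
      X p (\<lambda>q. g q (Y q) (Z q)) = g p (D X Y p) (Z p) + g p (Y p) (D X Z p)"
    by (rule *[THEN conjunct2, rule_format, OF assms(4,5) _ assms(3)])
qed

lemma levi_civita_connection: "levi_civita M W g D \<Longrightarrow> affine_connection M W D"
  unfolding levi_civita_def by simp

lemma levi_civita_subset: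
  assumes "V \<subseteq> W" "levi_civita M W g D"
  shows "levi_civita M V g D"
proof -
  have sub: "\<And>V'. V' \<subseteq> V \<Longrightarrow> V' \<subseteq> W"
    using assms(1) by blast
  show ?thesis
    using assms(2) sub unfolding levi_civita_def affine_connection_def by simp
qed

lemma smooth_fun_indicator: "openin (topo M) W \<Longrightarrow> smooth_fun M W (indicator W)"
  by (rule smooth_fun_cong[OF _ smooth_fun_const[of W 1]]) auto

text \<open>Locality in the differentiated field: multiplying it by the indicator function of \<open>W\<close> changes
  \<open>D X Y\<close> on \<open>W\<close> by \<open>X\<close> of a constant, that is not at all, and erases the values outside \<open>W\<close>. This is needed
  because identities between fields hold on \<open>W\<close> only, while connections act on functions defined
  everywhere.\<close>

lemma connection_cong_right:
  assumes D: "affine_connection M W D" "openin (topo M) W" "p \<in> W"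
    and X: "X \<in> vector_fields M W" and Y: "Y \<in> vector_fields M W" and Y': "Y' \<in> vector_fields M W"
    and eq: "\<And>q. q \<in> W \<Longrightarrow> Y q = Y' q"
  shows "D X Y p = D X Y' p"
proof -
  let ?i = "indicator W :: 'a \<Rightarrow> real"
  have d: "X p ?i = 0"
    using vf_derivative_cong[OF D(2) X D(3), of ?i "\<lambda>_. 1"] vf_derivative_const[OF D(2) X D(3)] by simp
  have "D X (\<lambda>q. ?i q \<cdot> Z q) p = D X Z p" if "Z \<in> vector_fields M W" for Z
    using connection_scale_right[OF D(1,2) X that smooth_fun_indicator[OF D(2)] D(3)] d D(3)
    by (simp add: tvec_simps)
  moreover have "(\<lambda>q. ?i q \<cdot> Y q) = (\<lambda>q. ?i q \<cdot> Y' q)"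
    using eq by (auto simp: tvec_simps indicator_def)
  ultimately show ?thesis
    using Y Y' by metis
qed

text \<open>The difference tensor \<open>T\<close> of two such connections gives a trilinear form \<open>c\<close>, symmetric in its first
  two arguments and skew in its last two; such a form vanishes. As \<open>T X Y\<close> is itself a vector field, it may
  be inserted as last argument, so the positivity of the metric finishes the argument at the point.\<close>

lemma levi_civita_unique:
  assumes g: "riemannian_metric M W g" and W: "openin (topo M) W" "p \<in> W"
    and D: "levi_civita M W g D" and D': "levi_civita M W g D'"
    and X: "X \<in> vector_fields M W" and Y: "Y \<in> vector_fields M W"
  shows "D X Y p = D' X Y p"
proof -
  have vf: "D X Y \<in> vector_fields M W" "D' X Y \<in> vector_fields M W"
    if "X \<in> vector_fields M W" "Y \<in> vector_fields M W" for X Y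
    by (intro connection_vf[OF levi_civita_connection[OF D] W(1) that]
        connection_vf[OF levi_civita_connection[OF D'] W(1) that])+
  define T where "T X Y q = D X Y q - D' X Y q" for X Y q
  have T_vf: "T X Y \<in> vector_fields M W" if "X \<in> vector_fields M W" "Y \<in> vector_fields M W" for X Y
    unfolding T_def by (rule vf_diff[OF W(1) vf[OF that]])
  note field_tangent = vf_tangent[OF _ W(2)]
  define c where "c X Y Z = g p (T X Y p) (Z p)" for X Y Z
  have c_sym: "c X Y Z = c Y X Z" if XY: "X \<in> vector_fields M W" "Y \<in> vector_fields M W" for X Y Z
  proof -
    have "T X Y p = T Y X p"
      using levi_civita_torsion_free[OF D W XY] levi_civita_torsion_free[OF D' W XY]
      by (simp add: T_def algebra_simps)
    then show ?thesis
      by (simp add: c_def)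
  qed
  have c_skew: "c X Y Z = - c X Z Y"
    if V: "X \<in> vector_fields M W" "Y \<in> vector_fields M W" "Z \<in> vector_fields M W" for X Y Z
  proof -
    have "g p (D X Y p) (Z p) + g p (Y p) (D X Z p) = g p (D' X Y p) (Z p) + g p (Y p) (D' X Z p)"
      using levi_civita_metric[OF D W V] levi_civita_metric[OF D' W V] by simp
    moreover have "g p (Y p) (D X Z p) = g p (D X Z p) (Y p)" "g p (Y p) (D' X Z p) = g p (D' X Z p) (Y p)"
      by (intro metric_commute[OF g W(2)] field_tangent V vf)+
    ultimately show ?thesis
      using metric_bilinear(5)[OF g W(2)] V vf field_tangent by (simp add: c_def T_def)
  qed
  define Z where "Z = T X Y"
  have Z: "Z \<in> vector_fields M W"
    unfolding Z_def by (rule T_vf[OF X Y])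
  have "c X Y Z = 0"
    using c_sym[OF X Y, of Z] c_skew[OF Y X Z] c_sym[OF Y Z, of X] c_skew[OF Z Y X]
      c_sym[OF Z X, of Y] c_skew[OF X Z Y] by simp
  then have "g p (Z p) (Z p) = 0"
    by (simp add: c_def Z_def)
  then have "Z p = 0"
    using metric_pos[OF g W(2) field_tangent[OF Z] field_tangent[OF Z]] by (metis less_irrefl)
  then show ?thesis
    by (simp add: Z_def T_def)
qed

end

section \<open>Almost Kenmotsu structures\<close>

text \<open>The domain \<open>W\<close> is a parameter and every lemma speaks of fields on \<open>W\<close>. Statements about fields on
  smaller open sets follow by instantiating the locale there, which the lemma \<open>restrict\<close> permits.\<close>

locale almost_Kenmotsu_structure = smooth_mfd M
  for M :: "('a, 'e::euclidean_space) mfd" +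
  fixes W :: "'a set" and \<alpha> :: real
    and \<phi> :: "'a endo_field" and \<xi> :: "'a vfield" and \<eta> :: "'a form1" and g :: "'a form2"
    and D :: "'a vfield \<Rightarrow> 'a vfield \<Rightarrow> 'a vfield"
  assumes W: "openin (topo M) W"
    and almost_Kenmotsu: "almost_Kenmotsu M W \<alpha> \<phi> \<xi> \<eta> g"
    and levi_civita: "levi_civita M W g D"
begin

abbreviation \<XX> :: "'a vfield set" where "\<XX> \<equiv> vector_fields M W"

lemma contact: "almost_contact_metric M W \<phi> \<xi> \<eta> g" and closed: "closed_one_form M W \<eta>"
  using almost_Kenmotsu unfolding almost_Kenmotsu_def by auto

lemma endo: "endo_field M W \<phi>" and xi_vf: "\<xi> \<in> \<XX>" and one_form: "one_form M W \<eta>"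
  and metric: "riemannian_metric M W g"
  using contact unfolding almost_contact_metric_def by auto

lemma connection: "affine_connection M W D"
  using levi_civita unfolding levi_civita_def by auto

lemma restrict:
  assumes V: "openin (topo M) V" "V \<subseteq> W"
  shows "almost_Kenmotsu_structure M V \<alpha> \<phi> \<xi> \<eta> g D"
proof
  have sub: "\<And>V'. V' \<subseteq> V \<Longrightarrow> V' \<subseteq> W"
    using V by blast
  have "almost_contact_metric M V \<phi> \<xi> \<eta> g"
    using contact V(2) sub vf_subset[OF xi_vf V(2)]
    unfolding almost_contact_metric_def endo_field_def one_form_def riemannian_metric_def
    by (simp add: subset_iff)
  moreover have "closed_one_form M V \<eta>"
    using closed sub unfolding closed_one_form_def by blast
  ultimately show "almost_Kenmotsu M V \<alpha> \<phi> \<xi> \<eta> g"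
    using almost_Kenmotsu sub unfolding almost_Kenmotsu_def by blast
  show "levi_civita M V g D"
    by (rule levi_civita_subset[OF V(2) levi_civita])
qed (use V in auto)

lemma phi_vf: "X \<in> \<XX> \<Longrightarrow> (\<lambda>q. \<phi> q (X q)) \<in> \<XX>"
  using endo W unfolding endo_field_def by blast

lemma D_vf: "X \<in> \<XX> \<Longrightarrow> Y \<in> \<XX> \<Longrightarrow> D X Y \<in> \<XX>"
  by (rule connection_vf[OF connection W])

lemma smooth_eta: "X \<in> \<XX> \<Longrightarrow> smooth_fun M W (\<lambda>q. \<eta> q (X q))"
  using one_form W unfolding one_form_def by blast

lemma smooth_metric: "X \<in> \<XX> \<Longrightarrow> Y \<in> \<XX> \<Longrightarrow> smooth_fun M W (\<lambda>q. g q (X q) (Y q))"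
  using metric[unfolded riemannian_metric_def, THEN conjunct2, THEN conjunct2, THEN conjunct2, rule_format,
      OF W subset_refl] by blast

context
  fixes p assumes p: "p \<in> W"
begin

lemmas field_tangent = vf_tangent[OF _ p]
lemmas eta_linear = one_form_linear[OF one_form p]
lemmas g_bilinear = metric_bilinear[OF metric p]

lemma phi_tangent: "u \<in> tangent_space M p \<Longrightarrow> \<phi> p u \<in> tangent_space M p"
  using endo p unfolding endo_field_def by blast

lemma eta_xi: "\<eta> p (\<xi> p) = 1" and phi_xi: "\<phi> p (\<xi> p) = 0"
  using contact p unfolding almost_contact_metric_def by auto

lemma phi_phi: "u \<in> tangent_space M p \<Longrightarrow> \<phi> p (\<phi> p u) = - u + \<eta> p u \<cdot> \<xi> p"
  and eta_phi: "u \<in> tangent_space M p \<Longrightarrow> \<eta> p (\<phi> p u) = 0"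
  and g_phi_phi: "u \<in> tangent_space M p \<Longrightarrow> v \<in> tangent_space M p \<Longrightarrow>
    g p (\<phi> p u) (\<phi> p v) = g p u v - \<eta> p u * \<eta> p v"
  using contact p unfolding almost_contact_metric_def by auto

lemma g_commute: "u \<in> tangent_space M p \<Longrightarrow> v \<in> tangent_space M p \<Longrightarrow> g p u v = g p v u"
  and g_pos: "u \<in> tangent_space M p \<Longrightarrow> u \<noteq> 0 \<Longrightarrow> g p u u > 0"
  by (blast intro: metric_commute[OF metric p] metric_pos[OF metric p])+

lemmas g_zero = g_bilinear(1)[OF tangent_space_zero] g_bilinear(6)[OF tangent_space_zero]

lemma g_xi: "u \<in> tangent_space M p \<Longrightarrow> g p u (\<xi> p) = \<eta> p u"
  using g_phi_phi[of u "\<xi> p"] field_tangent[OF xi_vf] phi_tangent by (simp add: phi_xi eta_xi g_zero)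

lemma g_xi_left: "u \<in> tangent_space M p \<Longrightarrow> g p (\<xi> p) u = \<eta> p u"
  using g_xi[of u] g_commute[OF field_tangent[OF xi_vf], of u] by simp

lemma g_phi_skew:
  assumes "u \<in> tangent_space M p" "v \<in> tangent_space M p"
  shows "g p (\<phi> p u) v = - g p u (\<phi> p v)"
proof -
  have "g p (\<phi> p u) (\<phi> p (\<phi> p v)) = g p u (\<phi> p v)"
    using assms by (simp add: g_phi_phi phi_tangent eta_phi)
  moreover have "g p (\<phi> p u) (\<phi> p (\<phi> p v)) = - g p (\<phi> p u) v"
    using assms by (simp add: phi_phi g_bilinear phi_tangent tangent_space_intros field_tangent[OF xi_vf] g_xi eta_phi)
  ultimately show ?thesis by simp
qed

lemma torsion_free: "X \<in> \<XX> \<Longrightarrow> Y \<in> \<XX> \<Longrightarrow> lie_bracket M X Y p = D X Y p - D Y X p"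
  and metric_compatible: "X \<in> \<XX> \<Longrightarrow> Y \<in> \<XX> \<Longrightarrow> Z \<in> \<XX> \<Longrightarrow>
    X p (\<lambda>q. g q (Y q) (Z q)) = g p (D X Y p) (Z p) + g p (Y p) (D X Z p)"
  by (rule levi_civita_torsion_free[OF levi_civita W p] levi_civita_metric[OF levi_civita W p]; assumption)+

lemmas derivative_cong = vf_derivative_cong[OF W _ p]

end

text \<open>The field \<open>\<xi>\<close> has constant length, so its derivatives are orthogonal to it.\<close>

lemma eta_D_xi:
  assumes p: "p \<in> W" and X: "X \<in> \<XX>"
  shows "\<eta> p (D X \<xi> p) = 0"
proof -
  have "X p (\<lambda>q. g q (\<xi> q) (\<xi> q)) = X p (\<lambda>_. 1)"
    by (rule derivative_cong[OF p X]) (simp add: g_xi vf_tangent[OF xi_vf] eta_xi)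
  then have "g p (D X \<xi> p) (\<xi> p) + g p (\<xi> p) (D X \<xi> p) = 0"
    using metric_compatible[OF p X xi_vf xi_vf] vf_derivative_const[OF W X p] by simp
  then show ?thesis
    using g_xi[OF p] g_xi_left[OF p] field_tangent[OF p] D_vf[OF X xi_vf] by simp
qed

lemma derivative_eta:
  assumes p: "p \<in> W" and X: "X \<in> \<XX>" and Y: "Y \<in> \<XX>"
  shows "X p (\<lambda>q. \<eta> q (Y q)) = \<eta> p (D X Y p) + g p (D X \<xi> p) (Y p)"
proof -
  have "X p (\<lambda>q. \<eta> q (Y q)) = X p (\<lambda>q. g q (Y q) (\<xi> q))"
    by (rule derivative_cong[OF p X]) (simp add: g_xi vf_tangent[OF Y])
  then show ?thesis
    using metric_compatible[OF p X Y xi_vf] g_commute[OF p field_tangent[OF p Y] field_tangent[OF p D_vf[OF X xi_vf]]]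
      g_xi[OF p field_tangent[OF p D_vf[OF X Y]]] by simp
qed

lemma eta_closed:
  assumes p: "p \<in> W" and X: "X \<in> \<XX>" and Y: "Y \<in> \<XX>"
  shows "X p (\<lambda>q. \<eta> q (Y q)) - Y p (\<lambda>q. \<eta> q (X q)) = \<eta> p (lie_bracket M X Y p)"
  using closed W p X Y unfolding closed_one_form_def ext_d1_def by (auto simp: algebra_simps)

text \<open>This is the closedness of \<open>\<eta>\<close>, the form dual to \<open>\<xi>\<close>: the Hessian of a local potential of \<open>\<eta>\<close> is
  symmetric.\<close>

lemma D_xi_symmetric:
  assumes p: "p \<in> W" and X: "X \<in> \<XX>" and Y: "Y \<in> \<XX>"
  shows "g p (D X \<xi> p) (Y p) = g p (D Y \<xi> p) (X p)"
  using eta_closed[OF p X Y] derivative_eta[OF p X Y] derivative_eta[OF p Y X] torsion_free[OF p X Y]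
    eta_linear[OF p] field_tangent[OF p] D_vf X Y by simp

lemma lie_derivative_endo_vf:
  assumes X: "X \<in> \<XX>"
  shows "lie_derivative_endo M \<xi> \<phi> X \<in> \<XX>"
  unfolding lie_derivative_endo_def
  by (intro vf_diff[OF W] vf_lie_bracket[OF W] phi_vf xi_vf X)

lemma h_prime_vf:
  assumes X: "X \<in> \<XX>"
  shows "h_prime M \<alpha> \<phi> \<xi> X \<in> \<XX>"
  unfolding h_prime_def
  by (rule vf_scale[OF smooth_fun_const[OF W] lie_derivative_endo_vf[OF phi_vf[OF X]]])

text \<open>This compares two computations of the Lie derivative \<open>\<L>\<^sub>\<xi>\<Phi>\<close>. As \<open>\<Phi>(\<xi>, \<cdot>) = 0\<close>, Cartan's formula
  turns \<open>d\<Phi> = 2\<alpha> \<eta>\<and>\<Phi>\<close> into \<open>\<L>\<^sub>\<xi>\<Phi> = 2\<alpha>\<Phi>\<close>. On the other hand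
  \<open>(\<L>\<^sub>\<xi>\<Phi>)(X, Y) = (\<L>\<^sub>\<xi>g)(X, \<phi>Y) + g(X, (\<L>\<^sub>\<xi>\<phi>)Y)\<close>, and \<open>\<L>\<^sub>\<xi>g\<close> is twice the symmetric form
  \<open>g(D\<^sub>X\<xi>, Y)\<close>.\<close>

lemma D_xi_lie_derivative_phi:
  assumes p: "p \<in> W" and X: "X \<in> \<XX>" and Y: "Y \<in> \<XX>"
  shows "2 * g p (D X \<xi> p) (\<phi> p (Y p)) + g p (X p) (lie_derivative_endo M \<xi> \<phi> Y p)
    = 2 * \<alpha> * g p (X p) (\<phi> p (Y p))"
proof -
  define Z where "Z = (\<lambda>q. \<phi> q (Y q))"
  have Z: "Z \<in> \<XX>"
    unfolding Z_def by (rule phi_vf[OF Y])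
  note vfs = X Y Z xi_vf D_vf vf_lie_bracket[OF W]
  have "ext_d2 M (fundamental_form \<phi> g) \<xi> X Y p = 2 * \<alpha> * wedge12 \<eta> (fundamental_form \<phi> g) \<xi> X Y p"
    using almost_Kenmotsu W p X Y xi_vf unfolding almost_Kenmotsu_def by blast
  moreover have "X p (\<lambda>q. g q (\<xi> q) (\<phi> q (Y q))) = X p (\<lambda>_. 0)"
    by (rule derivative_cong[OF p X])
      (use g_commute g_xi vf_tangent phi_tangent eta_phi xi_vf Y in metis)
  moreover have "Y p (\<lambda>q. g q (\<xi> q) (\<phi> q (X q))) = Y p (\<lambda>_. 0)"
    by (rule derivative_cong[OF p Y])
      (use g_commute g_xi vf_tangent phi_tangent eta_phi xi_vf X in metis)
  moreover have "g p (lie_bracket M X Y p) (\<phi> p (\<xi> p)) = 0" "g p (X p) (\<phi> p (\<xi> p)) = 0"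
    "g p (Y p) (\<phi> p (\<xi> p)) = 0"
    using vfs field_tangent[OF p] by (simp_all add: phi_xi[OF p] g_zero[OF p])
  moreover have "g p (\<xi> p) (\<phi> p (u p)) = 0" if "u \<in> \<XX>" for u
    using g_commute[OF p] g_xi[OF p] field_tangent[OF p] phi_tangent[OF p] eta_phi[OF p] xi_vf that by metis
  ultimately have dPhi: "\<xi> p (\<lambda>q. g q (X q) (Z q)) - g p (lie_bracket M \<xi> X p) (Z p)
      + g p (lie_bracket M \<xi> Y p) (\<phi> p (X p)) = 2 * \<alpha> * g p (X p) (Z p)"
    using X Y vf_derivative_const[OF W X p, of 0] vf_derivative_const[OF W Y p, of 0]
    by (simp add: ext_d2_def wedge12_def fundamental_form_def eta_xi[OF p] Z_def)
  have swap: "g p (lie_bracket M \<xi> Y p) (\<phi> p (X p)) = - g p (X p) (\<phi> p (lie_bracket M \<xi> Y p))"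
    using g_phi_skew[OF p] g_commute[OF p] vfs field_tangent[OF p] phi_tangent[OF p]
    by (metis add.inverse_inverse)
  have "\<xi> p (\<lambda>q. g q (X q) (Z q)) = g p (D \<xi> X p) (Z p) + g p (X p) (D \<xi> Z p)"
    by (rule metric_compatible[OF p xi_vf X Z])
  moreover have "D \<xi> X p = lie_bracket M \<xi> X p + D X \<xi> p" "D \<xi> Z p = lie_bracket M \<xi> Z p + D Z \<xi> p"
    using torsion_free[OF p xi_vf X] torsion_free[OF p xi_vf Z] by simp_all
  moreover have "g p (X p) (D Z \<xi> p) = g p (D X \<xi> p) (Z p)"
    using D_xi_symmetric[OF p X Z] g_commute[OF p] vfs field_tangent[OF p] by simp
  ultimately have "2 * g p (D X \<xi> p) (Z p) + g p (X p) (lie_bracket M \<xi> Z p)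
      - g p (X p) (\<phi> p (lie_bracket M \<xi> Y p)) = 2 * \<alpha> * g p (X p) (Z p)"
    using dPhi swap g_bilinear[OF p] vfs field_tangent[OF p] by simp
  moreover have "lie_derivative_endo M \<xi> \<phi> Y p = lie_bracket M \<xi> Z p - \<phi> p (lie_bracket M \<xi> Y p)"
    by (simp add: lie_derivative_endo_def Z_def)
  ultimately show ?thesis
    using g_bilinear(10)[OF p] vfs field_tangent[OF p] phi_tangent[OF p] by (simp add: Z_def)
qed

text \<open>Let \<open>N\<close> be the difference of the two sides. In the preceding identity for the fields \<open>N\<close> and \<open>\<phi>X\<close>, the
  formula \<open>\<phi>\<^sup>2 = - I + \<eta> \<otimes> \<xi>\<close> and the definition of \<open>h'\<close> express \<open>g(D\<^sub>N\<xi>, X)\<close>, which by symmetry is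
  \<open>g(N, D\<^sub>X\<xi>)\<close>, through \<open>X\<close> and \<open>h'X\<close>. The result says that \<open>N\<close> has length zero.\<close>

lemma D_xi:
  assumes p: "p \<in> W" and X: "X \<in> \<XX>" and "\<alpha> \<noteq> 0"
  shows "D X \<xi> p = \<alpha> \<cdot> (X p - \<eta> p (X p) \<cdot> \<xi> p + h_prime M \<alpha> \<phi> \<xi> X p)"
proof -
  define N where "N = (\<lambda>q. D X \<xi> q - \<alpha> \<cdot> (X q - \<eta> q (X q) \<cdot> \<xi> q + h_prime M \<alpha> \<phi> \<xi> X q))"
  have N: "N \<in> \<XX>"
    unfolding N_def
    by (intro vf_diff[OF W] vf_add vf_scale smooth_fun_const W smooth_eta D_vf h_prime_vf X xi_vf)
  have h: "lie_derivative_endo M \<xi> \<phi> (\<lambda>q. \<phi> q (X q)) p = (2 * \<alpha>) \<cdot> h_prime M \<alpha> \<phi> \<xi> X p"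
    using \<open>\<alpha> \<noteq> 0\<close> by (simp add: h_prime_def tvec_simps)
  note vfs = X N xi_vf D_vf h_prime_vf
  have "2 * g p (D N \<xi> p) (\<phi> p (\<phi> p (X p))) + g p (N p) ((2 * \<alpha>) \<cdot> h_prime M \<alpha> \<phi> \<xi> X p)
    = 2 * \<alpha> * g p (N p) (\<phi> p (\<phi> p (X p)))"
    using D_xi_lie_derivative_phi[OF p N phi_vf[OF X]] by (simp add: h)
  then have "- g p (D N \<xi> p) (X p) + \<alpha> * g p (N p) (h_prime M \<alpha> \<phi> \<xi> X p)
    = \<alpha> * (- g p (N p) (X p) + \<eta> p (X p) * \<eta> p (N p))"
    using vfs field_tangent[OF p]
    by (simp add: phi_phi[OF p] g_bilinear[OF p] tangent_space_intros g_xi[OF p] eta_D_xi[OF p]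
        algebra_simps)
  moreover have "g p (D N \<xi> p) (X p) = g p (N p) (D X \<xi> p)"
    using D_xi_symmetric[OF p N X] g_commute[OF p] vfs field_tangent[OF p] by simp
  moreover have "g p (N p) (N p) = g p (N p) (D X \<xi> p) - \<alpha> * (g p (N p) (X p)
      - \<eta> p (X p) * \<eta> p (N p) + g p (N p) (h_prime M \<alpha> \<phi> \<xi> X p))"
    using vfs field_tangent[OF p]
    by (subst (2) N_def) (simp add: g_bilinear[OF p] tangent_space_intros g_xi[OF p])
  ultimately have "g p (N p) (N p) = 0"
    by (simp add: algebra_simps)
  then have "N p = 0"
    using g_pos[OF p field_tangent[OF p N]] by (metis less_irrefl)
  then show ?thesis
    by (simp add: N_def)
qed

end

section \<open>The deformed structure\<close>

definition conformal_factor :: "real \<Rightarrow> ('a \<Rightarrow> real) \<Rightarrow> 'a \<Rightarrow> real" where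
  "conformal_factor \<alpha> t p = exp (- 2 * \<alpha> * t p)"

lemma D_conformal_metric_eq:
  "D_conformal_metric \<alpha> t \<eta> g p u v
    = conformal_factor \<alpha> t p * g p u v + (1 - conformal_factor \<alpha> t p) * (\<eta> p u * \<eta> p v)"
  by (simp add: D_conformal_metric_def conformal_factor_def)

text \<open>With \<open>\<eta> = dt\<close> the metric is locally \<open>dt\<^sup>2 + g\<^sub>t\<close>, where \<open>g\<^sub>t\<close> is a family of metrics on the leaves of
  \<open>ker \<eta>\<close>, and the deformation replaces \<open>g\<^sub>t\<close> by \<open>E g\<^sub>t\<close> with \<open>E = exp(- 2\<alpha>t)\<close>. On each leaf \<open>E\<close> is constant, so
  the leafwise connection stays the same. The derivative of \<open>E\<close> lowers the shape operator
  \<open>X \<mapsto> D\<^sub>X\<xi>\<close> by \<open>\<alpha>\<close> on \<open>ker \<eta>\<close>, and the \<open>\<xi>\<close>-component of the connection, being minus the second fundamental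
  form, changes accordingly. With \<open>P X = X - \<eta>(X)\<xi>\<close>, the correction to \<open>D\<^sub>X Y\<close> is
  \<open>((1 - E) g(D\<^sub>X\<xi>, Y) + \<alpha>E g(P X, P Y)) \<xi> - \<alpha> (\<eta>(Y) P X + \<eta>(X) P Y)\<close>;
  the term \<open>2\<alpha> \<eta>(X) \<eta>(Y) \<xi>\<close> below comes from expanding \<open>P\<close>.\<close>

definition conformal_connection :: "real \<Rightarrow> ('a \<Rightarrow> real) \<Rightarrow> 'a vfield \<Rightarrow> 'a form1 \<Rightarrow> 'a form2 \<Rightarrow>
    ('a vfield \<Rightarrow> 'a vfield \<Rightarrow> 'a vfield) \<Rightarrow> 'a vfield \<Rightarrow> 'a vfield \<Rightarrow> 'a vfield" where
  "conformal_connection \<alpha> t \<xi> \<eta> g D X Y p =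
     D X Y p - (\<alpha> * \<eta> p (Y p)) \<cdot> X p - (\<alpha> * \<eta> p (X p)) \<cdot> Y p +
     ((1 - conformal_factor \<alpha> t p) * g p (D X \<xi> p) (Y p)
      + \<alpha> * conformal_factor \<alpha> t p * (g p (X p) (Y p) - \<eta> p (X p) * \<eta> p (Y p))
      + 2 * \<alpha> * (\<eta> p (X p) * \<eta> p (Y p))) \<cdot> \<xi> p"

locale almost_Kenmotsu_potential = almost_Kenmotsu_structure M W \<alpha> \<phi> \<xi> \<eta> g D
  for M :: "('a, 'e::euclidean_space) mfd" and W \<alpha> \<phi> \<xi> \<eta> g D +
  fixes t :: "'a \<Rightarrow> real"
  assumes potential: "is_differential M W \<eta> t"
begin

abbreviation E :: "'a \<Rightarrow> real" where "E \<equiv> conformal_factor \<alpha> t"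

abbreviation g' :: "'a form2" where "g' \<equiv> D_conformal_metric \<alpha> t \<eta> g"

abbreviation D\<^sub>0 :: "'a vfield \<Rightarrow> 'a vfield \<Rightarrow> 'a vfield" where
  "D\<^sub>0 \<equiv> conformal_connection \<alpha> t \<xi> \<eta> g D"

lemma restrict_potential:
  assumes V: "openin (topo M) V" "V \<subseteq> W"
  shows "almost_Kenmotsu_potential M V \<alpha> \<phi> \<xi> \<eta> g D t"
proof -
  interpret V: almost_Kenmotsu_structure M V \<alpha> \<phi> \<xi> \<eta> g D
    by (rule restrict[OF V])
  show ?thesis
  proof
    show "is_differential M V \<eta> t"
      using potential V smooth_fun_subset[OF V] unfolding is_differential_def by blast
  qed
qed

lemma smooth_t: "smooth_fun M W t"
  using potential unfolding is_differential_def by blast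

lemma smooth_E: "smooth_fun M W E"
  unfolding conformal_factor_def by (intro smooth_fun_intros W smooth_t)

lemma derivative_E:
  assumes p: "p \<in> W" and X: "X \<in> \<XX>"
  shows "X p E = - 2 * \<alpha> * E p * \<eta> p (X p)"
proof -
  have "\<eta> p (X p) = X p t"
    using potential p vf_tangent[OF X p] unfolding is_differential_def by blast
  moreover have "smooth_fun M W (\<lambda>q. - 2 * \<alpha> * t q)"
    by (intro smooth_fun_intros W smooth_t)
  ultimately show ?thesis
    using vf_derivative_exp[OF W X p, of "\<lambda>q. - 2 * \<alpha> * t q"]
      vf_derivative_cmult[OF W X p smooth_t, of "- 2 * \<alpha>"]
    by (simp add: conformal_factor_def[abs_def])
qed

text \<open>Positivity is clear from \<open>g'(u, u) = E g(\<phi>u, \<phi>u) + \<eta>(u)\<^sup>2\<close>, since \<open>\<phi>u = 0\<close> only for multiples of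
  \<open>\<xi>\<close>. Using the original form of \<open>g'\<close> instead would need a Cauchy-Schwarz argument where \<open>E > 1\<close>.\<close>

lemma conformal_metric: "riemannian_metric M W g'"
  unfolding riemannian_metric_def
proof (intro conjI ballI allI impI)
  fix p u v w c assume p: "p \<in> W" and T: "u \<in> tangent_space M p" "v \<in> tangent_space M p"
    "w \<in> tangent_space M p"
  show "g' p (c \<cdot> u + v) w = c * g' p u w + g' p v w"
    using T by (simp add: D_conformal_metric_eq g_bilinear[OF p] eta_linear[OF p] tangent_space_intros
        algebra_simps)
next
  fix p u v assume "p \<in> W" "u \<in> tangent_space M p" "v \<in> tangent_space M p"
  then show "g' p u v = g' p v u"
    using g_commute[of p u v] by (simp add: D_conformal_metric_eq)
next
  fix p u assume p: "p \<in> W" and u: "u \<in> tangent_space M p" "u \<noteq> 0"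
  have *: "g' p u u = E p * g p (\<phi> p u) (\<phi> p u) + (\<eta> p u)\<^sup>2"
    using u by (simp add: D_conformal_metric_eq g_phi_phi[OF p] algebra_simps power2_eq_square)
  show "g' p u u > 0"
  proof (cases "\<phi> p u = 0")
    case True
    have "\<phi> p 0 = 0"
      using phi_phi[OF p field_tangent[OF p xi_vf]] by (simp add: phi_xi[OF p] eta_xi[OF p] tvec_simps)
    then have "u = \<eta> p u \<cdot> \<xi> p"
      using phi_phi[OF p u(1)] True by (simp add: tvec_simps)
    then have "\<eta> p u \<noteq> 0"
      using u(2) by (auto simp: tvec_simps)
    then show ?thesis
      unfolding * True by (simp add: g_zero[OF p] tangent_space_zero)
  next
    case False
    then have "g p (\<phi> p u) (\<phi> p u) > 0"
      using g_pos[OF p phi_tangent[OF p u(1)]] by blast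
    then show ?thesis
      unfolding * by (simp add: add_pos_nonneg conformal_factor_def)
  qed
next
  fix V X Y assume V: "openin (topo M) V" "V \<subseteq> W" and vfs: "X \<in> vector_fields M V" "Y \<in> vector_fields M V"
  interpret V: almost_Kenmotsu_potential M V \<alpha> \<phi> \<xi> \<eta> g D t
    by (rule restrict_potential[OF V])
  show "smooth_fun M V (\<lambda>p. g' p (X p) (Y p))"
    unfolding D_conformal_metric_eq
    by (intro smooth_fun_intros V.W V.smooth_E V.smooth_metric V.smooth_eta vfs)
qed

lemma conformal_contact: "almost_contact_metric M W \<phi> \<xi> \<eta> g'"
proof -
  have "g' p (\<phi> p u) (\<phi> p v) = g' p u v - \<eta> p u * \<eta> p v"
    if "p \<in> W" "u \<in> tangent_space M p" "v \<in> tangent_space M p" for p u v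
    using that by (simp add: D_conformal_metric_eq g_phi_phi eta_phi algebra_simps)
  then show ?thesis
    using contact conformal_metric unfolding almost_contact_metric_def by blast
qed

lemma conformal_fundamental_form:
  assumes "p \<in> W" "v \<in> tangent_space M p"
  shows "fundamental_form \<phi> g' p u v = E p * fundamental_form \<phi> g p u v"
  using assms by (simp add: fundamental_form_def D_conformal_metric_eq eta_phi)

text \<open>The fundamental form of the deformed structure is \<open>E \<Phi>\<close>, and
  \<open>d(E \<Phi>) = dE \<and> \<Phi> + E d\<Phi> = - 2\<alpha>E \<eta>\<and>\<Phi> + 2\<alpha>E \<eta>\<and>\<Phi>\<close>.\<close>

lemma conformal_fundamental_form_closed:
  assumes p: "p \<in> W" and X: "X \<in> \<XX>" and Y: "Y \<in> \<XX>" and Z: "Z \<in> \<XX>"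
  shows "ext_d2 M (fundamental_form \<phi> g') X Y Z p = 0"
proof -
  let ?\<Phi> = "fundamental_form \<phi> g"
  have leibniz: "X p (\<lambda>q. fundamental_form \<phi> g' q (Y q) (Z q))
      = E p * X p (\<lambda>q. ?\<Phi> q (Y q) (Z q)) - 2 * \<alpha> * E p * \<eta> p (X p) * ?\<Phi> p (Y p) (Z p)"
    if X: "X \<in> \<XX>" and Y: "Y \<in> \<XX>" and Z: "Z \<in> \<XX>" for X Y Z
  proof -
    have "X p (\<lambda>q. fundamental_form \<phi> g' q (Y q) (Z q)) = X p (\<lambda>q. E q * ?\<Phi> q (Y q) (Z q))"
      by (rule derivative_cong[OF p X]) (simp add: conformal_fundamental_form vf_tangent[OF Z])
    also have "\<dots> = E p * X p (\<lambda>q. ?\<Phi> q (Y q) (Z q)) + ?\<Phi> p (Y p) (Z p) * X p E"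
      unfolding fundamental_form_def
      by (rule vf_derivative_mult[OF W X p smooth_E smooth_metric[OF Y phi_vf[OF Z]]])
    finally show ?thesis
      by (simp add: derivative_E[OF p X])
  qed
  have "ext_d2 M ?\<Phi> X Y Z p = 2 * \<alpha> * wedge12 \<eta> ?\<Phi> X Y Z p"
    using almost_Kenmotsu W p X Y Z unfolding almost_Kenmotsu_def by blast
  then have "E p * (ext_d2 M ?\<Phi> X Y Z p - 2 * \<alpha> * wedge12 \<eta> ?\<Phi> X Y Z p) = 0"
    by simp
  moreover have "ext_d2 M (fundamental_form \<phi> g') X Y Z p
      = E p * (ext_d2 M ?\<Phi> X Y Z p - 2 * \<alpha> * wedge12 \<eta> ?\<Phi> X Y Z p)"
    unfolding ext_d2_def wedge12_def leibniz[OF X Y Z] leibniz[OF Y X Z] leibniz[OF Z X Y]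
      conformal_fundamental_form[OF p vf_tangent[OF X p]] conformal_fundamental_form[OF p vf_tangent[OF Y p]]
      conformal_fundamental_form[OF p vf_tangent[OF Z p]]
    by (simp add: algebra_simps)
  ultimately show ?thesis by simp
qed

lemma conformal_almost_cosymplectic: "almost_cosymplectic M W \<phi> \<xi> \<eta> g'"
  unfolding almost_cosymplectic_def
proof (intro conjI allI impI ballI conformal_contact closed)
  fix V X Y Z p
  assume V: "openin (topo M) V" "V \<subseteq> W"
    and vfs: "p \<in> V" "X \<in> vector_fields M V" "Y \<in> vector_fields M V" "Z \<in> vector_fields M V"
  interpret V: almost_Kenmotsu_potential M V \<alpha> \<phi> \<xi> \<eta> g D t
    by (rule restrict_potential[OF V])
  show "ext_d2 M (fundamental_form \<phi> g') X Y Z p = 0"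
    by (rule V.conformal_fundamental_form_closed[OF vfs])
qed

section \<open>The Levi-Civita connection of the deformed metric\<close>

lemma conformal_connection_vf:
  assumes X: "X \<in> \<XX>" and Y: "Y \<in> \<XX>"
  shows "D\<^sub>0 X Y \<in> \<XX>"
  unfolding conformal_connection_def
  by (intro vf_add vf_diff[OF W] vf_scale smooth_fun_intros W smooth_E smooth_eta smooth_metric D_vf
      X Y xi_vf)

lemma conformal_connection_torsion_free:
  assumes p: "p \<in> W" and X: "X \<in> \<XX>" and Y: "Y \<in> \<XX>"
  shows "D\<^sub>0 X Y p - D\<^sub>0 Y X p = lie_bracket M X Y p"
  using torsion_free[OF p X Y] D_xi_symmetric[OF p X Y] g_commute[OF p field_tangent[OF p X] field_tangent[OF p Y]]
  by (simp add: conformal_connection_def tvec_simps algebra_simps)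

text \<open>The computation rests on \<open>g' = E k + \<eta> \<otimes> \<eta>\<close> with \<open>k = g - \<eta> \<otimes> \<eta>\<close>: the derivative of \<open>E\<close> contributes
  \<open>- 2\<alpha>E \<eta>(X) k(Y, Z)\<close>, which the \<open>\<alpha>\<close>-terms of the correction tensor reproduce, and the derivatives of \<open>\<eta>\<close>
  contribute the second fundamental form of \<open>g\<close> with the factor \<open>1 - E\<close>.\<close>

lemma conformal_connection_metric:
  assumes p: "p \<in> W" and X: "X \<in> \<XX>" and Y: "Y \<in> \<XX>" and Z: "Z \<in> \<XX>"
  shows "X p (\<lambda>q. g' q (Y q) (Z q)) = g' p (D\<^sub>0 X Y p) (Z p) + g' p (Y p) (D\<^sub>0 X Z p)"
proof -
  note smooth = smooth_fun_intros W smooth_E smooth_eta smooth_metric Y Z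
  note deriv = vf_derivative_add[OF W X p] vf_derivative_diff[OF W X p] vf_derivative_mult[OF W X p]
  let ?k = "\<lambda>q. g q (Y q) (Z q) - \<eta> q (Y q) * \<eta> q (Z q)"
  have sk: "smooth_fun M W ?k" "smooth_fun M W (\<lambda>q. \<eta> q (Y q) * \<eta> q (Z q))"
    by (intro smooth)+
  have "X p (\<lambda>q. g' q (Y q) (Z q)) = X p (\<lambda>q. E q * ?k q + \<eta> q (Y q) * \<eta> q (Z q))"
    by (simp add: D_conformal_metric_eq algebra_simps)
  also have "\<dots> = E p * X p ?k + ?k p * X p E + X p (\<lambda>q. \<eta> q (Y q) * \<eta> q (Z q))"
    using deriv(1)[OF smooth_fun_mult[OF W smooth_E sk(1)] sk(2)] deriv(3)[OF smooth_E sk(1)] by simp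
  also have "X p ?k = X p (\<lambda>q. g q (Y q) (Z q)) - X p (\<lambda>q. \<eta> q (Y q) * \<eta> q (Z q))"
    by (rule deriv(2)[OF smooth_metric[OF Y Z] sk(2)])
  also have "X p (\<lambda>q. \<eta> q (Y q) * \<eta> q (Z q))
      = \<eta> p (Y p) * X p (\<lambda>q. \<eta> q (Z q)) + \<eta> p (Z p) * X p (\<lambda>q. \<eta> q (Y q))"
    by (rule deriv(3)[OF smooth_eta[OF Y] smooth_eta[OF Z]])
  finally have L: "X p (\<lambda>q. g' q (Y q) (Z q)) =
     E p * (g p (D X Y p) (Z p) + g p (Y p) (D X Z p)) - 2 * \<alpha> * E p * \<eta> p (X p) * ?k p
     + (1 - E p) * (\<eta> p (Y p) * (\<eta> p (D X Z p) + g p (D X \<xi> p) (Z p))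
        + \<eta> p (Z p) * (\<eta> p (D X Y p) + g p (D X \<xi> p) (Y p)))"
    unfolding derivative_E[OF p X] derivative_eta[OF p X Y] derivative_eta[OF p X Z]
      metric_compatible[OF p X Y Z]
    by (simp add: algebra_simps)
  have T: "X p \<in> tangent_space M p" "Y p \<in> tangent_space M p" "Z p \<in> tangent_space M p"
    "\<xi> p \<in> tangent_space M p" "D X Y p \<in> tangent_space M p" "D X Z p \<in> tangent_space M p"
    using field_tangent[OF p] X Y Z xi_vf D_vf by auto
  show ?thesis
    unfolding L
    unfolding D_conformal_metric_eq conformal_connection_def
    using g_commute[OF p T(2) T(1)]
    by (simp add: T g_bilinear[OF p] eta_linear[OF p] tangent_space_intros g_xi[OF p] g_xi_left[OF p]
        eta_xi[OF p] algebra_simps)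
qed

lemma conformal_levi_civita: "levi_civita M W g' D\<^sub>0"
  unfolding levi_civita_def affine_connection_def
proof (intro conjI allI impI ballI)
  fix V assume V: "openin (topo M) V" "V \<subseteq> W"
  interpret V: almost_Kenmotsu_potential M V \<alpha> \<phi> \<xi> \<eta> g D t
    by (rule restrict_potential[OF V])
  note rules = connection_rules[OF V.connection V.W]
  {
    fix X Y assume X: "X \<in> vector_fields M V" and Y: "Y \<in> vector_fields M V"
    note vfs = X Y V.xi_vf V.D_vf
    show "D\<^sub>0 X Y \<in> vector_fields M V"
      by (rule V.conformal_connection_vf[OF X Y])
    {
      fix p f assume f: "smooth_fun M V f" and p: "p \<in> V"
      have "D (\<lambda>q. f q \<cdot> X q) \<xi> p = f p \<cdot> D X \<xi> p" "D (\<lambda>q. f q \<cdot> X q) Y p = f p \<cdot> D X Y p"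
        "D X (\<lambda>q. f q \<cdot> Y q) p = X p f \<cdot> Y p + f p \<cdot> D X Y p"
        by (intro rules vfs f p)+
      note D_eqs = this
      have T: "X p \<in> tangent_space M p" "Y p \<in> tangent_space M p" "\<xi> p \<in> tangent_space M p"
        "D X \<xi> p \<in> tangent_space M p"
        using V.field_tangent[OF p] vfs by auto
      show "D\<^sub>0 (\<lambda>q. f q \<cdot> X q) Y p = f p \<cdot> D\<^sub>0 X Y p"
        "D\<^sub>0 X (\<lambda>q. f q \<cdot> Y q) p = X p f \<cdot> Y p + f p \<cdot> D\<^sub>0 X Y p"
        unfolding conformal_connection_def D_eqs
        by (simp_all add: V.g_bilinear[OF p] V.eta_linear[OF p] T)
          (simp_all add: tvec_simps algebra_simps)
    next
      fix p assume p: "p \<in> V"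
      show "D\<^sub>0 X Y p - D\<^sub>0 Y X p = lie_bracket M X Y p"
        by (rule V.conformal_connection_torsion_free[OF p X Y])
      fix Z assume Z: "Z \<in> vector_fields M V"
      show "X p (\<lambda>q. g' q (Y q) (Z q)) = g' p (D\<^sub>0 X Y p) (Z p) + g' p (Y p) (D\<^sub>0 X Z p)"
        by (rule V.conformal_connection_metric[OF p X Y Z])
      have "D (\<lambda>q. X q + Y q) \<xi> p = D X \<xi> p + D Y \<xi> p" "D (\<lambda>q. X q + Y q) Z p = D X Z p + D Y Z p"
        "D X (\<lambda>q. Y q + Z q) p = D X Y p + D X Z p"
        by (intro rules vfs Z p)+
      note D_eqs = this
      have T: "X p \<in> tangent_space M p" "Y p \<in> tangent_space M p" "\<xi> p \<in> tangent_space M p"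
        "Z p \<in> tangent_space M p"
        "D X \<xi> p \<in> tangent_space M p" "D Y \<xi> p \<in> tangent_space M p"
        using V.field_tangent[OF p] vfs Z by auto
      have sums: "X + Y = (\<lambda>q. X q + Y q)" "Y + Z = (\<lambda>q. Y q + Z q)"
        by (simp_all add: fun_eq_iff)
      show "D\<^sub>0 (X + Y) Z p = D\<^sub>0 X Z p + D\<^sub>0 Y Z p" "D\<^sub>0 X (Y + Z) p = D\<^sub>0 X Y p + D\<^sub>0 X Z p"
        unfolding conformal_connection_def sums D_eqs
        by (simp_all add: V.g_bilinear[OF p] V.eta_linear[OF p] T)
          (simp_all add: tvec_simps algebra_simps)
    }
  }
qed

section \<open>Curvature of the deformed metric\<close>

context
  fixes D' assumes D': "levi_civita M W g' D'"
begin

lemma D'_vf: "X \<in> \<XX> \<Longrightarrow> Y \<in> \<XX> \<Longrightarrow> D' X Y \<in> \<XX>"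
  by (rule connection_vf[OF levi_civita_connection[OF D'] W])

lemma D'_eq: "p \<in> W \<Longrightarrow> X \<in> \<XX> \<Longrightarrow> Y \<in> \<XX> \<Longrightarrow> D' X Y p = D\<^sub>0 X Y p"
  by (rule levi_civita_unique[OF conformal_metric W _ D' conformal_levi_civita])

text \<open>The shape operator of the deformed metric differs from the one of \<open>g\<close> by \<open>- \<alpha>\<close> times
  the projection onto \<open>ker \<eta>\<close>.\<close>

lemma D'_xi:
  assumes p: "p \<in> W" and Y: "Y \<in> \<XX>"
  shows "D' Y \<xi> p = D Y \<xi> p + (- \<alpha> \<cdot> Y p + (\<alpha> * \<eta> p (Y p)) \<cdot> \<xi> p)"
proof -
  have "D' Y \<xi> p = D\<^sub>0 Y \<xi> p"
    by (rule D'_eq[OF p Y xi_vf])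
  then show ?thesis
    by (simp add: conformal_connection_def eta_xi[OF p] g_xi[OF p] field_tangent[OF p] Y D_vf xi_vf eta_D_xi[OF p Y]
       tvec_simps algebra_simps)
qed

text \<open>The coefficient \<open>s\<close> collects the terms that come from the \<open>\<xi>\<close>-component of the correction tensor.
  Only its symmetry in \<open>X\<close> and \<open>Y\<close> matters for the curvature.\<close>

lemma D'_D'_xi:
  assumes p: "p \<in> W" and X: "X \<in> \<XX>" and Y: "Y \<in> \<XX>"
  defines "s \<equiv> (1 - E p) * (g p (D X \<xi> p) (D Y \<xi> p) - \<alpha> * g p (D X \<xi> p) (Y p))
    + \<alpha> * E p * (g p (X p) (D Y \<xi> p) - \<alpha> * g p (X p) (Y p) + \<alpha> * \<eta> p (X p) * \<eta> p (Y p))"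
  shows "D' X (D' Y \<xi>) p = D X (D Y \<xi>) p - \<alpha> \<cdot> D X Y p + (\<alpha> * X p (\<lambda>q. \<eta> q (Y q))) \<cdot> \<xi> p
    + (\<alpha> * \<eta> p (Y p)) \<cdot> D X \<xi> p - (\<alpha> * \<eta> p (X p)) \<cdot> D' Y \<xi> p + s \<cdot> \<xi> p"
proof -
  note vfs = X Y xi_vf D_vf
  define Q where "Q = D' Y \<xi>"
  have Q: "Q \<in> \<XX>"
    unfolding Q_def by (rule D'_vf[OF Y xi_vf])
  have Qp: "Q p = D Y \<xi> p + (- \<alpha> \<cdot> Y p + (\<alpha> * \<eta> p (Y p)) \<cdot> \<xi> p)"
    unfolding Q_def by (rule D'_xi[OF p Y])
  let ?f = "\<lambda>q. \<alpha> * \<eta> q (Y q)"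
  have f: "smooth_fun M W ?f"
    by (intro smooth_fun_intros smooth_eta W Y)
  have c: "smooth_fun M W (\<lambda>_. - \<alpha>)"
    by (rule smooth_fun_const[OF W])
  note rules = connection_rules[OF connection W]
  have vf3: "(\<lambda>q. - \<alpha> \<cdot> Y q) \<in> \<XX>" "(\<lambda>q. ?f q \<cdot> \<xi> q) \<in> \<XX>"
    by (intro vf_scale f c vfs)+
  have "D X Q p = D X (\<lambda>q. D Y \<xi> q + (- \<alpha> \<cdot> Y q + ?f q \<cdot> \<xi> q)) p"
    by (rule connection_cong_right[OF connection W p X Q])
      (auto intro!: vf_add D_vf vf3 vfs D'_xi simp: Q_def)
  also have "\<dots> = D X (D Y \<xi>) p + (D X (\<lambda>q. - \<alpha> \<cdot> Y q) p + D X (\<lambda>q. ?f q \<cdot> \<xi> q) p)"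
    by (simp add: rules(3) vfs vf3 vf_add p)
  also have "\<dots> = D X (D Y \<xi>) p + ((X p (\<lambda>_. - \<alpha>) \<cdot> Y p + - \<alpha> \<cdot> D X Y p)
      + (X p ?f \<cdot> \<xi> p + ?f p \<cdot> D X \<xi> p))"
    by (simp only: rules(5)[OF X Y c p] rules(5)[OF X xi_vf f p])
  also have "X p ?f = \<alpha> * X p (\<lambda>q. \<eta> q (Y q))"
    by (rule vf_derivative_cmult[OF W X p smooth_eta[OF Y]])
  also have "X p (\<lambda>_. - \<alpha>) = 0"
    by (rule vf_derivative_const[OF W X p])
  finally have DQ: "D X Q p = D X (D Y \<xi>) p + ((0 \<cdot> Y p + - \<alpha> \<cdot> D X Y p)
      + ((\<alpha> * X p (\<lambda>q. \<eta> q (Y q))) \<cdot> \<xi> p + (\<alpha> * \<eta> p (Y p)) \<cdot> D X \<xi> p))" .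
  have T: "X p \<in> tangent_space M p" "Y p \<in> tangent_space M p" "\<xi> p \<in> tangent_space M p"
    "D X \<xi> p \<in> tangent_space M p" "D Y \<xi> p \<in> tangent_space M p"
    using field_tangent[OF p] vfs by auto
  have etaQ: "\<eta> p (Q p) = 0"
    unfolding Qp by (simp add: T eta_linear[OF p] tangent_space_intros eta_xi[OF p] eta_D_xi[OF p Y])
  have gQ: "g p (D X \<xi> p) (Q p) = g p (D X \<xi> p) (D Y \<xi> p) - \<alpha> * g p (D X \<xi> p) (Y p)"
    "g p (X p) (Q p) = g p (X p) (D Y \<xi> p) - \<alpha> * g p (X p) (Y p) + \<alpha> * \<eta> p (X p) * \<eta> p (Y p)"
    unfolding Qp by (simp_all add: T g_bilinear[OF p] tangent_space_intros g_xi[OF p] eta_D_xi[OF p X])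
  have "D' X Q p = D\<^sub>0 X Q p"
    by (rule D'_eq[OF p X Q])
  also have "\<dots> = D X Q p - (\<alpha> * \<eta> p (X p)) \<cdot> Q p + s \<cdot> \<xi> p"
    unfolding conformal_connection_def etaQ gQ s_def by (simp add: tvec_simps)
  finally show ?thesis
    using DQ unfolding Q_def by (simp add: tvec_simps)
qed

text \<open>Antisymmetrising the second derivatives removes \<open>s\<close> and, because \<open>\<eta>\<close> is closed, the derivatives
  of \<open>\<eta>\<close>; what is left over \<open>R\<close> is \<open>2\<alpha> (\<eta>(Y) D\<^sub>X\<xi> - \<eta>(X) D\<^sub>Y\<xi>) - \<alpha>\<^sup>2 (\<eta>(Y) X - \<eta>(X) Y)\<close>, and \<open>D_xi\<close>
  turns this into the stated terms.\<close>

lemma conformal_curvature_xi: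
  assumes p: "p \<in> W" and X: "X \<in> \<XX>" and Y: "Y \<in> \<XX>" and "\<alpha> \<noteq> 0"
  shows "curvature M D' X Y \<xi> p = curvature M D X Y \<xi> p
    + \<alpha>\<^sup>2 \<cdot> (\<eta> p (Y p) \<cdot> X p - \<eta> p (X p) \<cdot> Y p)
    + (2 * \<alpha>\<^sup>2) \<cdot> (\<eta> p (Y p) \<cdot> h_prime M \<alpha> \<phi> \<xi> X p - \<eta> p (X p) \<cdot> h_prime M \<alpha> \<phi> \<xi> Y p)"
proof (rule ext)
  fix f
  have B: "lie_bracket M X Y \<in> \<XX>"
    by (rule vf_lie_bracket[OF W X Y])
  have T: "X p \<in> tangent_space M p" "Y p \<in> tangent_space M p"
    "D X \<xi> p \<in> tangent_space M p" "D Y \<xi> p \<in> tangent_space M p"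
    using field_tangent[OF p] X Y D_vf xi_vf by auto
  note sym = D_xi_symmetric[OF p X Y] g_commute[OF p T(1,2)] g_commute[OF p T(3,4)]
    g_commute[OF p T(1) T(4)] g_commute[OF p T(2) T(3)]
  note * = D'_D'_xi[OF p X Y] D'_D'_xi[OF p Y X] D'_xi[OF p B] D'_xi[OF p X] D'_xi[OF p Y]
    torsion_free[OF p X Y] D_xi[OF p X \<open>\<alpha> \<noteq> 0\<close>] D_xi[OF p Y \<open>\<alpha> \<noteq> 0\<close>]
  note ** = *[THEN fun_cong, of f, unfolded scale_def plus_fun_apply minus_apply uminus_apply]
  have eta_B: "\<eta> p (lie_bracket M X Y p) = X p (\<lambda>q. \<eta> q (Y q)) - Y p (\<lambda>q. \<eta> q (X q))"
    by (rule eta_closed[OF p X Y, symmetric])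
  show "curvature M D' X Y \<xi> p f = (curvature M D X Y \<xi> p
    + \<alpha>\<^sup>2 \<cdot> (\<eta> p (Y p) \<cdot> X p - \<eta> p (X p) \<cdot> Y p)
    + (2 * \<alpha>\<^sup>2) \<cdot> (\<eta> p (Y p) \<cdot> h_prime M \<alpha> \<phi> \<xi> X p - \<eta> p (X p) \<cdot> h_prime M \<alpha> \<phi> \<xi> Y p)) f"
    unfolding curvature_def plus_fun_apply minus_apply scale_def ** eta_B sym
    by (simp add: algebra_simps power2_eq_square)
qed

end

lemma conformal_kappa_nullity:
  assumes nullity: "kappa_mu_prime_nullity M W \<alpha> \<kappa> (- 2 * \<alpha>\<^sup>2) \<phi> \<xi> \<eta> D" and "\<alpha> \<noteq> 0"
    and D': "levi_civita M W g' D'"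
  shows "kappa_nullity M W (\<kappa> + \<alpha>\<^sup>2) \<xi> \<eta> D'"
  unfolding kappa_nullity_def
proof (intro allI impI ballI)
  fix V X Y p
  assume V: "openin (topo M) V" "V \<subseteq> W"
    and vfs: "X \<in> vector_fields M V" "Y \<in> vector_fields M V" and p: "p \<in> V"
  interpret V: almost_Kenmotsu_potential M V \<alpha> \<phi> \<xi> \<eta> g D t
    by (rule restrict_potential[OF V])
  have "levi_civita M V g' D'"
    by (rule levi_civita_subset[OF V(2) D'])
  from V.conformal_curvature_xi[OF this p vfs \<open>\<alpha> \<noteq> 0\<close>]
  show "curvature M D' X Y \<xi> p = (\<kappa> + \<alpha>\<^sup>2) \<cdot> (\<eta> p (Y p) \<cdot> X p - \<eta> p (X p) \<cdot> Y p)"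
    using nullity[unfolded kappa_mu_prime_nullity_def, rule_format, OF V vfs p]
    by (simp add: tvec_simps algebra_simps)
qed

end

theorem proposition5:
  fixes M :: "('a, 'e::euclidean_space) mfd" and n :: nat and \<alpha> \<kappa> \<mu> :: real
    and \<phi> :: "'a endo_field" and \<xi> :: "'a vfield" and \<eta> :: "'a form1" and g :: "'a form2"
    and D :: "'a vfield \<Rightarrow> 'a vfield \<Rightarrow> 'a vfield"
    and U :: "'a set" and t :: "'a \<Rightarrow> real"
  assumes "smooth_manifold M" and "DIM('e) = 2 * n + 1"
    and "\<alpha> > 0"
    and "almost_Kenmotsu M (topspace (topo M)) \<alpha> \<phi> \<xi> \<eta> g"
    and "levi_civita M (topspace (topo M)) g D"
    and "h_prime_nonzero M (topspace (topo M)) \<alpha> \<phi> \<xi>"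
    and "kappa_mu_prime_nullity M (topspace (topo M)) \<alpha> \<kappa> \<mu> \<phi> \<xi> \<eta> D"
    and "\<mu> = - 2 * \<alpha>\<^sup>2"
    and "openin (topo M) U" and "is_differential M U \<eta> t"
  shows "almost_cosymplectic M U \<phi> \<xi> \<eta> (D_conformal_metric \<alpha> t \<eta> g) \<and>
    (\<exists>D'. levi_civita M U (D_conformal_metric \<alpha> t \<eta> g) D') \<and>
    (\<forall>D'. levi_civita M U (D_conformal_metric \<alpha> t \<eta> g) D' \<longrightarrow>
       kappa_nullity M U (\<kappa> + \<alpha>\<^sup>2) \<xi> \<eta> D')"
proof -
  interpret whole: almost_Kenmotsu_structure M "topspace (topo M)" \<alpha> \<phi> \<xi> \<eta> g D
    by unfold_locales (use assms in auto)
  have U: "U \<subseteq> topspace (topo M)"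
    by (rule openin_subset[OF assms(9)])
  interpret local: almost_Kenmotsu_structure M U \<alpha> \<phi> \<xi> \<eta> g D
    by (rule whole.restrict[OF assms(9) U])
  interpret almost_Kenmotsu_potential M U \<alpha> \<phi> \<xi> \<eta> g D t
    by unfold_locales (rule assms(10))
  have "kappa_mu_prime_nullity M U \<alpha> \<kappa> (- 2 * \<alpha>\<^sup>2) \<phi> \<xi> \<eta> D"
    using assms(7) U unfolding assms(8) kappa_mu_prime_nullity_def by (meson subset_trans)
  moreover have "\<alpha> \<noteq> 0"
    using assms(3) by simp
  ultimately show ?thesis
    using conformal_almost_cosymplectic conformal_levi_civita conformal_kappa_nullity by blast
qed

end
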